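(* Let $V$ be a finite-dimensional complex vector space, let $\mathcal V=(V_1,\dots,V_m)\in\mathrm{Gr}(k_1,V)\times\cdots\times\mathrm{Gr}(k_m,V)$ be a configuration of linear subspaces of $V$, and let $\omega=(\omega_1,\dots,\omega_m)$ be a set of positive numbers (weights). Then $\mathcal V$ is polystable with respect to $\omega$ if and only if there is a balance metric on $V$ for the weighted configuration $(\mathcal V,\omega)$.
   Context: $\mathrm{Gr}(k,V)$ is the Grassmannian of $k$-dimensional subspaces of $V$. The normalized total weighted dimension of $\mathcal V$ is $\wp_\omega(\mathcal V)=\frac1{\dim V}\sum_i\omega_i\dim V_i$. A nonzero subspace $H\subset V$ induces the subconfiguration $\mathcal H=(V_1\cap H,\dots,V_m\cap H)$ of subspaces of $H$, with $\wp_\omega(\mathcal H)=\frac1{\dim H}\sum_i\omega_i\dim(V_i\cap H)$. $\mathcal V$ is semistable (resp. stable) with respect to $\omega$ if $\wp_\omega(\mathcal H)\le\wp_\omega(\mathcal V)$ (resp. $<$) for every nonzero proper subspace $H\subset V$. $\mathcal V$ is the direct sum of subconfigurations $\mathcal H_1,\dots,\mathcal H_l$ induced by subspaces $H_1,\dots,H_l\subset V$ if $V=\bigoplus_q H_q$ and $V_i=\bigoplus_q (V_i\cap H_q)$ for all $i$. A semistable configuration is polystable if it is a direct sum of a finite number of stable subconfigurations (each $\mathcal H_q$ stable as a configuration in $H_q$) of the same normalized total weighted dimension. A Hermitian metric $h$ on $V$ is a balance metric for $(\mathcal V,\omega)$ if $\sum_{i=1}^m\omega_i\pi_{V_i}=\wp_\omega(\mathcal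 V)\,\mathrm{Id}_V$, where $\pi_{V_i}:V\to V_i\hookrightarrow V$ is the orthogonal projection onto $V_i$ with respect to $h$. *)

theory Defs
  imports Complex_Main "HOL-Library.FuncSet"
begin

locale fd_complex_vector_space =
  finite_dimensional_vector_space scale Basis
  for scale :: "complex \<Rightarrow> 'v::ab_group_add \<Rightarrow> 'v"  (infixr \<open>*s\<close> 75)
  and Basis :: "'v set"
begin

text \<open>
  A configuration of \<open>m\<close> subspaces of an ambient subspace \<open>W\<close> is a family \<open>V :: nat \<Rightarrow> 'v set\<close>
  of which only the members with index in \<open>{1..m}\<close> matter. The ambient space is an explicit
  argument because stability is also needed for configurations inside proper subspaces; the whole
  space is \<open>UNIV\<close>.
\<close>

definition Gr :: "nat \<Rightarrow> 'v set \<Rightarrow> 'v set set" where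
  "Gr k W = {S. subspace S \<and> S \<subseteq> W \<and> dim S = k}"

text \<open>For \<open>W = {0}\<close> the quotient is \<open>0\<close> by the convention \<open>x / 0 = 0\<close>.\<close>

definition normalized_weighted_dim ::
    "nat \<Rightarrow> (nat \<Rightarrow> real) \<Rightarrow> 'v set \<Rightarrow> (nat \<Rightarrow> 'v set) \<Rightarrow> real" where
  "normalized_weighted_dim m \<omega> W V = (\<Sum>i = 1..m. \<omega> i * real (dim (V i))) / real (dim W)"

definition induced :: "(nat \<Rightarrow> 'v set) \<Rightarrow> 'v set \<Rightarrow> nat \<Rightarrow> 'v set" where
  "induced V H = (\<lambda>i. V i \<inter> H)"

definition semistable :: "nat \<Rightarrow> (nat \<Rightarrow> real) \<Rightarrow> 'v set \<Rightarrow> (nat \<Rightarrow> 'v set) \<Rightarrow> bool" where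
  "semistable m \<omega> W V \<longleftrightarrow>
    (\<forall>H. subspace H \<and> H \<noteq> {0} \<and> H \<subset> W \<longrightarrow>
      normalized_weighted_dim m \<omega> H (induced V H) \<le> normalized_weighted_dim m \<omega> W V)"

definition stable :: "nat \<Rightarrow> (nat \<Rightarrow> real) \<Rightarrow> 'v set \<Rightarrow> (nat \<Rightarrow> 'v set) \<Rightarrow> bool" where
  "stable m \<omega> W V \<longleftrightarrow>
    (\<forall>H. subspace H \<and> H \<noteq> {0} \<and> H \<subset> W \<longrightarrow>
      normalized_weighted_dim m \<omega> H (induced V H) < normalized_weighted_dim m \<omega> W V)"

text \<open>
  Internal direct sum: the addition map from the product of the subspaces \<open>H 1, \<dots>, H l\<close> to \<open>W\<close>
  is a bijection. For \<open>l = 0\<close> this says \<open>W = {0}\<close>.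
\<close>

definition direct_sum :: "'v set \<Rightarrow> nat \<Rightarrow> (nat \<Rightarrow> 'v set) \<Rightarrow> bool" where
  "direct_sum W l H \<longleftrightarrow>
    (\<forall>q\<in>{1..l}. subspace (H q)) \<and>
    bij_betw (\<lambda>x. \<Sum>q = 1..l. x q) (\<Pi>\<^sub>E q\<in>{1..l}. H q) W"

definition config_direct_sum ::
    "nat \<Rightarrow> 'v set \<Rightarrow> (nat \<Rightarrow> 'v set) \<Rightarrow> nat \<Rightarrow> (nat \<Rightarrow> 'v set) \<Rightarrow> bool" where
  "config_direct_sum m W V l H \<longleftrightarrow>
    direct_sum W l H \<and> (\<forall>i\<in>{1..m}. direct_sum (V i) l (\<lambda>q. V i \<inter> H q))"

definition polystable :: "nat \<Rightarrow> (nat \<Rightarrow> real) \<Rightarrow> 'v set \<Rightarrow> (nat \<Rightarrow> 'v set) \<Rightarrow> bool" where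
  "polystable m \<omega> W V \<longleftrightarrow>
    semistable m \<omega> W V \<and>
    (\<exists>l H. (\<forall>q\<in>{1..l}. H q \<noteq> {0}) \<and>
      config_direct_sum m W V l H \<and>
      (\<forall>q\<in>{1..l}. stable m \<omega> (H q) (induced V (H q))) \<and>
      (\<forall>q\<in>{1..l}. \<forall>r\<in>{1..l}.
        normalized_weighted_dim m \<omega> (H q) (induced V (H q)) =
        normalized_weighted_dim m \<omega> (H r) (induced V (H r))))"

text \<open>
  Linear in the first argument. Conjugate symmetry makes \<open>h x x\<close> real, so positivity of its real
  part is positive definiteness.
\<close>

definition hermitian_metric :: "('v \<Rightarrow> 'v \<Rightarrow> complex) \<Rightarrow> bool" where
  "hermitian_metric h \<longleftrightarrow>
    (\<forall>x y z. h (x + y) z = h x z + h y z) \<and>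
    (\<forall>c x y. h (c *s x) y = c * h x y) \<and>
    (\<forall>x y. h y x = cnj (h x y)) \<and>
    (\<forall>x. x \<noteq> 0 \<longrightarrow> Re (h x x) > 0)"

text \<open>
  The described vector exists and is unique when \<open>h\<close> is a Hermitian metric and \<open>S\<close> a subspace.
\<close>

definition orth_proj :: "('v \<Rightarrow> 'v \<Rightarrow> complex) \<Rightarrow> 'v set \<Rightarrow> 'v \<Rightarrow> 'v" where
  "orth_proj h S v = (THE p. p \<in> S \<and> (\<forall>s\<in>S. h (v - p) s = 0))"

definition balance_metric ::
    "nat \<Rightarrow> (nat \<Rightarrow> real) \<Rightarrow> (nat \<Rightarrow> 'v set) \<Rightarrow> ('v \<Rightarrow> 'v \<Rightarrow> complex) \<Rightarrow> bool" where
  "balance_metric m \<omega> V h \<longleftrightarrow>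
    hermitian_metric h \<and>
    (\<forall>v. (\<Sum>i = 1..m. complex_of_real (\<omega> i) *s orth_proj h (V i) v) =
         complex_of_real (normalized_weighted_dim m \<omega> UNIV V) *s v)"

end

end

theory Submission imports Defs begin

text \<open>
  Write \<open>\<mu>\<close> for the normalized total weighted dimension, \<open>\<Omega> = \<Sum>i. \<omega> i\<close>, and \<open>\<pi> i\<close> for the orthogonal
  projection onto \<open>V i\<close>.

  Suppose first that \<open>h\<close> is a balance metric. Compressing \<open>\<Sum>i. \<omega> i \<pi> i = \<mu> Id\<close> to a subspace \<open>K\<close> and
  taking traces gives \<open>\<Sum>i. \<omega> i tr (\<pi> i | K) = \<mu> dim K\<close>. Each \<open>tr (\<pi> i | K)\<close> is at least \<open>dim (V i \<inter> K)\<close>,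
  with equality exactly when \<open>\<pi> i\<close> maps \<open>K\<close> into itself (\<open>trace_compression_ge\<close>). So the configuration
  is semistable, and the subspaces at which equality holds are the common invariant subspaces of the
  \<open>\<pi> i\<close>. These projections are self-adjoint, hence the whole space is an orthogonal sum of irreducible
  common invariant subspaces; each of them has the same normalized dimension \<open>\<mu>\<close>, and is stable
  because it has no proper nonzero invariant subspaces (\<open>balanced_imp_polystable\<close>).

  Conversely, the orthogonal sum of balance metrics on the stable summands is a balance metric, so it is
  enough to treat one stable summand \<open>W\<close>. The case \<open>\<Omega> = \<mu>\<close> is trivial, since then every \<open>V i\<close> is all
  of \<open>W\<close>. Otherwise put \<open>w i = \<omega> i / (\<Omega> - \<mu>)\<close> and, for a positive form \<open>h\<close>, let \<open>T h\<close> be the form whose value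
  at \<open>x\<close> is \<open>\<Sum>i. w i dist (x, V i)\<^sup>2\<close>, the distance being that of \<open>h\<close>. The balance equation says \<open>T h = h\<close>.
  Two properties of \<open>T\<close> carry the existence proof. It is monotone, because a distance is an infimum. And
  the trace of \<open>T h\<close> relative to \<open>h\<close> is \<open>\<Sum>i. w i (dim W - dim (V i)) = dim W\<close>, whatever \<open>h\<close> is; therefore a
  positive form with \<open>h \<le> T h\<close> is already a fixed point.

  Such a form is obtained from the increasing sequence \<open>h\<close>, \<open>T h + h\<close>, \<open>T (T h + h) + h\<close>, and so on. If it
  were bounded, two consecutive terms \<open>R\<close> and \<open>R'\<close> would satisfy \<open>T R + h = R' \<le> R + \<delta> h\<close> with \<open>\<delta> < 1\<close>,
  and the traces relative to \<open>R\<close> would contradict each other (\<open>residual_iteration_unbounded\<close>). Since it is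
  unbounded, the added \<open>h\<close> disappears when the terms are divided by their traces, and a
  limit point \<open>Q\<close> is a nonzero semidefinite form with \<open>Q \<le> T Q\<close>, in the sense that \<open>T\<close> is computed with
  infima (\<open>residual_subsolution_exists\<close>). Let \<open>N\<close> be the radical of \<open>Q\<close>. Taking traces of this inequality
  in \<open>W / N\<close> bounds the weighted dimensions of \<open>V i \<inter> N\<close> from below (\<open>radical_codim_le\<close>), and this contradicts
  stability unless \<open>N = {0}\<close>. So \<open>Q\<close> is positive definite, and the trace identity turns \<open>Q \<le> T Q\<close> into
  \<open>Q = T Q\<close> (\<open>stable_imp_residual_fixed_point\<close>).
\<close>

section \<open>Convergent subsequences of bounded complex families\<close>

lemma complex_bounded_convergent_subseq:
  fixes f :: "nat \<Rightarrow> complex"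
  assumes "\<And>k. cmod (f k) \<le> C"
  obtains r l where "strict_mono r" "(\<lambda>k. f (r k)) \<longlonglongrightarrow> l"
proof -
  obtain r where r: "strict_mono r" "monoseq (\<lambda>n. Re (f (r n)))"
    using seq_monosub[of "\<lambda>k. Re (f k)"] by (auto simp: strict_mono_def)
  obtain s where s: "strict_mono s" "monoseq (\<lambda>n. Im (f (r (s n))))"
    using seq_monosub[of "\<lambda>k. Im (f (r k))"] by (auto simp: strict_mono_def)
  have "Bseq (\<lambda>n. Re (f (r n)))"
    by (rule BseqI'[of _ C]) (use assms abs_Re_le_cmod order_trans in fastforce)
  then obtain x where "(\<lambda>n. Re (f (r n))) \<longlonglongrightarrow> x"
    using r Bseq_monoseq_convergent convergent_def by blast
  then have x: "(\<lambda>n. Re (f (r (s n)))) \<longlonglongrightarrow> x"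
    using LIMSEQ_subseq_LIMSEQ[OF _ s(1)] by (fastforce simp: o_def)
  have "Bseq (\<lambda>n. Im (f (r (s n))))"
    by (rule BseqI'[of _ C]) (use assms abs_Im_le_cmod order_trans in fastforce)
  then obtain y where y: "(\<lambda>n. Im (f (r (s n)))) \<longlonglongrightarrow> y"
    using s Bseq_monoseq_convergent convergent_def by blast
  have "(\<lambda>n. f (r (s n))) \<longlonglongrightarrow> Complex x y"
    using tendsto_Complex[OF x y] by simp
  then show thesis using that[of "r \<circ> s"] r s by (simp add: strict_mono_o)
qed

lemma finite_family_convergent_subseq:
  fixes f :: "nat \<Rightarrow> 'i \<Rightarrow> complex"
  assumes "finite I" "\<And>k i. i \<in> I \<Longrightarrow> cmod (f k i) \<le> C"
  obtains r l where "strict_mono r" "\<And>i. i \<in> I \<Longrightarrow> (\<lambda>k. f (r k) i) \<longlonglongrightarrow> l i"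
proof -
  have "\<exists>r l. strict_mono r \<and> (\<forall>i\<in>I. (\<lambda>k. f (r k) i) \<longlonglongrightarrow> l i)"
    using assms
  proof (induction I rule: finite_induct)
    case empty
    show ?case by (auto intro!: exI[of _ "\<lambda>k. k"] strict_monoI)
  next
    case (insert j I)
    then obtain r l where r: "strict_mono r" "\<forall>i\<in>I. (\<lambda>k. f (r k) i) \<longlonglongrightarrow> l i" by auto
    obtain s y where s: "strict_mono s" "(\<lambda>k. f (r (s k)) j) \<longlonglongrightarrow> y"
      using complex_bounded_convergent_subseq[of "\<lambda>k. f (r k) j" C] insert.prems by blast
    have "(\<lambda>k. f (r (s k)) i) \<longlonglongrightarrow> (l(j := y)) i" if "i \<in> insert j I" for i
    proof (cases "i = j")
      case False
      then have "(\<lambda>k. f (r k) i) \<longlonglongrightarrow> l i" using r that by blast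
      from LIMSEQ_subseq_LIMSEQ[OF this s(1)] False show ?thesis by (simp add: o_def)
    qed (use s in simp)
    then have "\<forall>i\<in>insert j I. (\<lambda>k. f ((r \<circ> s) k) i) \<longlonglongrightarrow> (l(j := y)) i" by simp
    then show ?case using strict_mono_o[OF r(1) s(1)] by blast
  qed
  then show thesis using that by blast
qed

context fd_complex_vector_space
begin

section \<open>Hermitian forms, orthonormal bases and orthogonal projections\<close>

definition hermitian_form :: "('v \<Rightarrow> 'v \<Rightarrow> complex) \<Rightarrow> bool" where
  "hermitian_form h \<longleftrightarrow>
    (\<forall>x y z. h (x + y) z = h x z + h y z) \<and>
    (\<forall>c x y. h (c *s x) y = c * h x y) \<and>
    (\<forall>x y. h y x = cnj (h x y))"

text \<open>
  Positivity is relative to a subspace: forms are sesquilinear on the whole space, but the forms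
  constructed on a summand of a configuration are controlled on that summand only.
\<close>

definition psd_on :: "'v set \<Rightarrow> ('v \<Rightarrow> 'v \<Rightarrow> complex) \<Rightarrow> bool" where
  "psd_on S h \<longleftrightarrow> (\<forall>x\<in>S. 0 \<le> Re (h x x))"

definition pos_on :: "'v set \<Rightarrow> ('v \<Rightarrow> 'v \<Rightarrow> complex) \<Rightarrow> bool" where
  "pos_on S h \<longleftrightarrow> (\<forall>x\<in>S. x \<noteq> 0 \<longrightarrow> 0 < Re (h x x))"

definition orthonormal_basis :: "('v \<Rightarrow> 'v \<Rightarrow> complex) \<Rightarrow> 'v set \<Rightarrow> 'v set \<Rightarrow> bool" where
  "orthonormal_basis h S B \<longleftrightarrow> finite B \<and> span B = S \<and>
    (\<forall>a\<in>B. \<forall>b\<in>B. h a b = (if a = b then 1 else 0))"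

lemma hermitian_metric_iff: "hermitian_metric h \<longleftrightarrow> hermitian_form h \<and> pos_on UNIV h"
  unfolding hermitian_metric_def hermitian_form_def pos_on_def
  by (simp only: ball_UNIV conj_assoc)

lemma hermitian_formI:
  assumes "\<And>x y z. h (x + y) z = h x z + h y z" "\<And>c x y. h (c *s x) y = c * h x y"
    "\<And>x y. h y x = cnj (h x y)"
  shows "hermitian_form h"
  unfolding hermitian_form_def by (intro conjI allI assms)

context
  fixes h :: "'v \<Rightarrow> 'v \<Rightarrow> complex"
  assumes h: "hermitian_form h"
begin

lemma form_add_left: "h (x + y) z = h x z + h y z"
  and form_scale_left: "h (c *s x) y = c * h x y"
  and form_cnj: "h y x = cnj (h x y)"
  by (fact h[unfolded hermitian_form_def, THEN conjunct1, rule_format]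
      h[unfolded hermitian_form_def, THEN conjunct2, THEN conjunct1, rule_format]
      h[unfolded hermitian_form_def, THEN conjunct2, THEN conjunct2, rule_format])+

lemma form_add_right: "h z (x + y) = h z x + h z y"
  by (metis form_add_left form_cnj complex_cnj_add)

lemma form_scale_right: "h y (c *s x) = cnj c * h y x"
  by (metis form_scale_left form_cnj complex_cnj_mult)

lemma form_zero_left [simp]: "h 0 y = 0"
  using form_add_left[of 0 0 y] by simp

lemma form_zero_right [simp]: "h y 0 = 0"
  using form_add_right[of y 0 0] by simp

lemma form_minus_left: "h (- x) y = - h x y"
  using form_add_left[of x "- x" y] by (simp add: add_eq_0_iff)

lemma form_minus_right: "h y (- x) = - h y x"
  using form_add_right[of y x "- x"] by (simp add: add_eq_0_iff)

lemma form_diff_left: "h (x - z) y = h x y - h z y"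
  using form_add_left[of x "- z" y] form_minus_left by simp

lemma form_diff_right: "h y (x - z) = h y x - h y z"
  using form_add_right[of y x "- z"] form_minus_right by simp

lemma form_sum_left: "h (sum f A) y = (\<Sum>a\<in>A. h (f a) y)"
  by (induction A rule: infinite_finite_induct) (simp_all add: form_add_left)

lemma form_sum_right: "h y (sum f A) = (\<Sum>a\<in>A. h y (f a))"
  by (induction A rule: infinite_finite_induct) (simp_all add: form_add_right)

lemma form_diag_real: "h x x = complex_of_real (Re (h x x))"
  by (metis form_cnj Reals_cnj_iff of_real_Re)

lemma form_zero_commute: "h x y = 0 \<longleftrightarrow> h y x = 0"
  by (metis form_cnj complex_cnj_zero)

lemma form_pythagoras:
  assumes "h x y = 0"
  shows "Re (h (x + y) (x + y)) = Re (h x x) + Re (h y y)"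
  using assms form_zero_commute[of x y] by (simp add: form_add_left form_add_right)

lemma form_diag_scale: "Re (h (c *s x) (c *s x)) = (cmod c)\<^sup>2 * Re (h x x)"
proof -
  have "h (c *s x) (c *s x) = (c * cnj c) * h x x"
    by (simp only: form_scale_left form_scale_right mult_ac)
  also have "c * cnj c = complex_of_real ((cmod c)\<^sup>2)"
    by (simp only: complex_norm_square)
  finally show ?thesis by (simp flip: of_real_power)
qed

text \<open>
  A substitute for the Cauchy--Schwarz inequality, good enough for all bounds below: after multiplying
  \<open>y\<close> by the phase of \<open>h x y\<close>, it is the statement that \<open>x - y\<close> has nonnegative square.
\<close>

lemma psd_entry_le:
  assumes S: "subspace S" and psd: "psd_on S h" and xy: "x \<in> S" "y \<in> S"
  shows "2 * cmod (h x y) \<le> Re (h x x) + Re (h y y)"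
proof (cases "h x y = 0")
  case True
  then show ?thesis using psd xy unfolding psd_on_def by (metis add_nonneg_nonneg mult_zero_right norm_zero)
next
  case False
  define u where "u = h x y / complex_of_real (cmod (h x y))"
  have u: "cmod u = 1" using False by (simp add: u_def norm_divide)
  have "h x (u *s y) = cnj u * h x y" by (simp add: form_scale_right)
  also have "\<dots> = complex_of_real (cmod (h x y))"
  proof -
    have "cnj (h x y) * h x y = complex_of_real (cmod (h x y) ^ 2)"
      by (metis complex_norm_square mult.commute)
    then show ?thesis using False by (simp add: u_def power2_eq_square)
  qed
  finally have c: "h x (u *s y) = complex_of_real (cmod (h x y))" .
  then have c': "h (u *s y) x = complex_of_real (cmod (h x y))"
    by (metis form_cnj complex_cnj_complex_of_real)
  have "x - u *s y \<in> S" using S xy by (simp add: subspace_diff subspace_scale)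
  then have "0 \<le> Re (h (x - u *s y) (x - u *s y))" using psd unfolding psd_on_def by blast
  also have "\<dots> = Re (h x x) + Re (h (u *s y) (u *s y)) - 2 * cmod (h x y)"
    by (simp add: form_diff_left form_diff_right c c')
  also have "Re (h (u *s y) (u *s y)) = Re (h y y)" using form_diag_scale[of u y] u by simp
  finally show ?thesis by simp
qed

text \<open>
  An isotropic vector of a semidefinite form lies in its radical: otherwise a large multiple of \<open>y\<close>
  would violate the previous bound.
\<close>

lemma psd_null:
  assumes S: "subspace S" and psd: "psd_on S h" and xy: "x \<in> S" "y \<in> S" and null: "Re (h y y) = 0"
  shows "h x y = 0"
proof (rule ccontr)
  assume nz: "h x y \<noteq> 0"
  \<comment> \<open>large enough that the cross term exceeds \<open>Re (h x x)\<close>\<close>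
  define t where "t = (Re (h x x) + 1) / cmod (h x y)"
  have "0 \<le> Re (h x x)" using psd xy unfolding psd_on_def by blast
  then have t0: "t > 0" using nz by (simp add: t_def)
  have "2 * cmod (h x (complex_of_real t *s y))
      \<le> Re (h x x) + Re (h (complex_of_real t *s y) (complex_of_real t *s y))"
    using S xy by (intro psd_entry_le[OF S psd]) (simp_all add: subspace_scale)
  also have "\<dots> = Re (h x x)" by (simp add: form_diag_scale null)
  also have "cmod (h x (complex_of_real t *s y)) = t * cmod (h x y)"
    using t0 by (simp add: form_scale_right norm_mult)
  also have "t * cmod (h x y) = Re (h x x) + 1" using nz by (simp add: t_def)
  finally show False using \<open>0 \<le> Re (h x x)\<close> by simp
qed

lemma orthonormal_basisD:
  assumes "orthonormal_basis h S B"
  shows "finite B" "span B = S" "B \<subseteq> S" "subspace S"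
    "\<And>a b. a \<in> B \<Longrightarrow> b \<in> B \<Longrightarrow> h a b = (if a = b then 1 else 0)"
  using assms span_superset[of B] subspace_span[of B] unfolding orthonormal_basis_def by auto

lemma orthonormal_coefficient:
  assumes "finite B" "\<forall>a\<in>B. \<forall>b\<in>B. h a b = (if a = b then 1 else 0)" "b \<in> B"
  shows "h (\<Sum>a\<in>B. f a *s a) b = f b"
proof -
  have "h (\<Sum>a\<in>B. f a *s a) b = (\<Sum>a\<in>B. f a * h a b)"
    by (simp add: form_sum_left form_scale_left)
  also have "\<dots> = (\<Sum>a\<in>B. if a = b then f a else 0)"
    using assms by (intro sum.cong) auto
  finally show ?thesis using assms by (simp add: sum.delta)
qed

lemma orthonormal_independent:
  assumes "finite B" "\<forall>a\<in>B. \<forall>b\<in>B. h a b = (if a = b then 1 else 0)"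
  shows "independent B"
  unfolding independent_explicit
  using assms orthonormal_coefficient[OF assms] by (metis form_zero_left)

lemma orthonormal_basis_card: "orthonormal_basis h S B \<Longrightarrow> card B = dim S"
  unfolding orthonormal_basis_def
  using orthonormal_independent dim_span_eq_card_independent by metis

lemma orthonormal_expand:
  assumes "orthonormal_basis h S B" "x \<in> S"
  shows "x = (\<Sum>b\<in>B. h x b *s b)"
proof -
  note B = orthonormal_basisD[OF assms(1)]
  obtain f where f: "x = (\<Sum>b\<in>B. f b *s b)"
    using assms(2) B(1,2) span_finite[of B] by auto
  have "h x b = f b" if "b \<in> B" for b
    unfolding f using B that by (intro orthonormal_coefficient) auto
  then show ?thesis using f by simp
qed

lemma orthonormal_parseval:
  assumes "orthonormal_basis h S B" "x \<in> S"
  shows "h x y = (\<Sum>b\<in>B. h x b * h b y)"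
proof -
  have "h x y = h (\<Sum>b\<in>B. h x b *s b) y" using orthonormal_expand[OF assms] by simp
  then show ?thesis by (simp add: form_sum_left form_scale_left)
qed

text \<open>
  Gram--Schmidt, run as a maximality argument: a largest orthonormal set between \<open>A\<close> and \<open>S\<close> spans \<open>S\<close>,
  as the normalized residual of any further vector would enlarge it.
\<close>

lemma orthonormal_basis_extend:
  assumes pos: "pos_on S h" and S: "subspace S" and A: "orthonormal_basis h T A" and TS: "T \<subseteq> S"
  obtains B where "A \<subseteq> B" "orthonormal_basis h S B"
proof -
  define P where "P C \<longleftrightarrow> finite C \<and> A \<subseteq> C \<and> C \<subseteq> S \<and>
    (\<forall>a\<in>C. \<forall>b\<in>C. h a b = (if a = b then 1 else 0))" for C
  have PA: "P A" using orthonormal_basisD[OF A] TS unfolding P_def by auto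
  have bound: "\<forall>C. P C \<longrightarrow> card C < Suc (dim S)"
    unfolding P_def using orthonormal_independent independent_card_le_dim less_Suc_eq_le by metis
  obtain C where C: "P C" and max: "\<And>C'. P C' \<Longrightarrow> card C' \<le> card C"
    using ex_has_greatest_nat[OF PA bound] by blast
  have sub: "span C \<subseteq> S" using C S span_minimal unfolding P_def by blast
  have "S \<subseteq> span C"
  proof (rule ccontr)
    assume "\<not> S \<subseteq> span C"
    then obtain x where x: "x \<in> S" "x \<notin> span C" by blast
    define y where "y = x - (\<Sum>a\<in>C. h x a *s a)"
    have inspan: "(\<Sum>a\<in>C. h x a *s a) \<in> span C"
      by (intro span_sum span_scale span_base)
    have y0: "y \<noteq> 0" using x inspan unfolding y_def by auto
    have yS: "y \<in> S" using x inspan sub S unfolding y_def by (auto intro: subspace_diff)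
    have yorth: "h y b = 0" if "b \<in> C" for b
      using C that orthonormal_coefficient[of C b "h x"] unfolding P_def y_def
      by (simp add: form_diff_left)
    have ry: "Re (h y y) > 0" using pos y0 yS unfolding pos_on_def by blast
    define z where "z = complex_of_real (1 / sqrt (Re (h y y))) *s y"
    have zz: "h z z = 1"
    proof -
      have "Re (h z z) = 1" unfolding z_def form_diag_scale using ry
        by (simp add: norm_divide power_divide)
      then show ?thesis by (metis form_diag_real of_real_1)
    qed
    have zo: "h z b = 0" "h b z = 0" if "b \<in> C" for b
      using yorth[OF that] form_zero_commute[of y b]
      unfolding z_def by (simp_all add: form_scale_left form_scale_right)
    have zS: "z \<in> S" using yS S unfolding z_def by (simp add: subspace_scale)
    have zC: "z \<notin> C" using zo zz by force
    have "P (insert z C)"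
      using C zz zo zS zC unfolding P_def by auto
    from max[OF this] show False using C zC unfolding P_def by simp
  qed
  with sub C have "orthonormal_basis h S C" unfolding orthonormal_basis_def P_def by auto
  with C that show thesis unfolding P_def by blast
qed

lemma orthonormal_basis_exists:
  assumes "pos_on S h" "subspace S"
  obtains B where "orthonormal_basis h S B"
proof -
  have "orthonormal_basis h {0} {}" unfolding orthonormal_basis_def by simp
  from orthonormal_basis_extend[OF assms this] assms(2) show thesis
    using that subspace_0 by blast
qed

text \<open>
  Positivity on \<open>S\<close> alone makes the projection onto \<open>S\<close> unique, so \<open>x\<close> may be any vector of the ambient
  space.
\<close>

lemma orth_projI:
  assumes "pos_on S h" "subspace S" "p \<in> S" "\<And>s. s \<in> S \<Longrightarrow> h (x - p) s = 0"
  shows "orth_proj h S x = p"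
  unfolding orth_proj_def
proof (rule the_equality)
  show "p \<in> S \<and> (\<forall>s\<in>S. h (x - p) s = 0)" using assms by blast
  fix q assume q: "q \<in> S \<and> (\<forall>s\<in>S. h (x - q) s = 0)"
  have pq: "p - q \<in> S" using assms q by (simp add: subspace_diff)
  have "h (p - q) (p - q) = h (x - q) (p - q) - h (x - p) (p - q)"
    by (simp add: form_diff_left)
  then have "h (p - q) (p - q) = 0" using assms q pq by simp
  then show "q = p" using assms(1) pq unfolding pos_on_def by fastforce
qed

context
  fixes S
  assumes pos: "pos_on S h" and S: "subspace S"
begin

lemma orth_proj_expand:
  assumes B: "orthonormal_basis h S B"
  shows "orth_proj h S x = (\<Sum>b\<in>B. h x b *s b)"
proof (rule orth_projI[OF pos S])
  show "(\<Sum>b\<in>B. h x b *s b) \<in> S"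
    using orthonormal_basisD[OF B] by (intro subspace_sum subspace_scale) auto
  fix s assume s: "s \<in> S"
  note e = orthonormal_expand[OF B s]
  have "h (x - (\<Sum>b\<in>B. h x b *s b)) b = 0" if "b \<in> B" for b
    using orthonormal_coefficient[of B b "h x"] orthonormal_basisD[OF B] that
    by (simp add: form_diff_left)
  then show "h (x - (\<Sum>b\<in>B. h x b *s b)) s = 0"
    by (subst e) (simp add: form_sum_right form_scale_right)
qed

lemma orth_proj_mem: "orth_proj h S x \<in> S"
  and orth_proj_residual: "s \<in> S \<Longrightarrow> h (x - orth_proj h S x) s = 0"
proof -
  obtain B where B: "orthonormal_basis h S B" using orthonormal_basis_exists[OF pos S] .
  show "orth_proj h S x \<in> S" unfolding orth_proj_expand[OF B]
    using orthonormal_basisD[OF B] by (intro subspace_sum subspace_scale) auto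
  assume s: "s \<in> S"
  note e = orthonormal_expand[OF B s]
  have "h (x - (\<Sum>b\<in>B. h x b *s b)) b = 0" if "b \<in> B" for b
    using orthonormal_coefficient[of B b "h x"] orthonormal_basisD[OF B] that
    by (simp add: form_diff_left)
  then show "h (x - orth_proj h S x) s = 0" unfolding orth_proj_expand[OF B]
    by (subst e) (simp add: form_sum_right form_scale_right)
qed

lemma orth_proj_add: "orth_proj h S (x + y) = orth_proj h S x + orth_proj h S y"
proof -
  obtain B where B: "orthonormal_basis h S B" using orthonormal_basis_exists[OF pos S] .
  show ?thesis unfolding orth_proj_expand[OF B]
    by (simp add: form_add_left scale_left_distrib sum.distrib)
qed

lemma orth_proj_scale: "orth_proj h S (c *s x) = c *s orth_proj h S x"
proof -
  obtain B where B: "orthonormal_basis h S B" using orthonormal_basis_exists[OF pos S] .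
  show ?thesis unfolding orth_proj_expand[OF B]
    by (simp add: form_scale_left scale_sum_right)
qed

lemma orth_proj_id: "x \<in> S \<Longrightarrow> orth_proj h S x = x"
  by (rule orth_projI[OF pos S]) simp_all

lemma orth_proj_self_adjoint: "h (orth_proj h S x) y = h x (orth_proj h S y)"
proof -
  have "h (orth_proj h S x) y = h (orth_proj h S x) (orth_proj h S y)"
    using orth_proj_residual[OF orth_proj_mem, of y x] form_zero_commute
    by (simp add: form_diff_left form_diff_right) (metis form_cnj)
  also have "\<dots> = h x (orth_proj h S y)"
    using orth_proj_residual[OF orth_proj_mem, of x y]
    by (simp add: form_diff_left)
  finally show ?thesis .
qed

lemma orth_proj_diag: "h (orth_proj h S x) x = h (orth_proj h S x) (orth_proj h S x)"
  by (metis orth_proj_self_adjoint orth_proj_id orth_proj_mem)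

lemma orth_proj_residual_diag:
  "h (x - orth_proj h S x) (x - orth_proj h S x) = h (x - orth_proj h S x) x"
  using orth_proj_residual[OF orth_proj_mem, of x x] by (simp add: form_diff_right)

lemma orth_proj_minimal:
  assumes W: "subspace W" "psd_on W h" "S \<subseteq> W" and s: "s \<in> S"
  shows "Re (h (x - orth_proj h S x) (x - orth_proj h S x)) \<le> Re (h (x - s) (x - s))"
proof -
  define p where "p = orth_proj h S x"
  have ps: "p - s \<in> S" using orth_proj_mem s S unfolding p_def by (simp add: subspace_diff)
  have "Re (h ((x - p) + (p - s)) ((x - p) + (p - s)))
      = Re (h (x - p) (x - p)) + Re (h (p - s) (p - s))"
    by (rule form_pythagoras) (simp add: p_def orth_proj_residual ps[unfolded p_def])
  moreover have "0 \<le> Re (h (p - s) (p - s))" using W ps unfolding psd_on_def by blast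
  ultimately show ?thesis unfolding p_def by simp
qed

end

text \<open>
  Both sides are the trace of the product of the two projections, \<open>\<Sum>a b. \<bar>h a b\<bar>\<^sup>2\<close>. The symmetry
  allows each trace to be computed in a basis adapted to the other subspace.
\<close>

lemma trace_orth_proj_symmetric:
  assumes S: "pos_on S h" "subspace S" and T: "pos_on T h" "subspace T"
    and A: "orthonormal_basis h S A" and B: "orthonormal_basis h T B"
  shows "(\<Sum>a\<in>A. h (orth_proj h T a) a) = (\<Sum>b\<in>B. h (orth_proj h S b) b)"
proof -
  have "(\<Sum>a\<in>A. h (orth_proj h T a) a) = (\<Sum>a\<in>A. \<Sum>b\<in>B. h a b * h b a)"
    by (simp add: orth_proj_expand[OF T B] form_sum_left form_scale_left)
  also have "\<dots> = (\<Sum>b\<in>B. \<Sum>a\<in>A. h b a * h a b)"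
    by (subst sum.swap) (simp add: mult.commute)
  also have "\<dots> = (\<Sum>b\<in>B. h (orth_proj h S b) b)"
    by (simp add: orth_proj_expand[OF S A] form_sum_left form_scale_left)
  finally show ?thesis .
qed

lemma trace_orth_proj:
  assumes W: "pos_on W h" "subspace W" and S: "subspace S" "S \<subseteq> W" and A: "orthonormal_basis h W A"
  shows "(\<Sum>a\<in>A. h (orth_proj h S a) a) = of_nat (dim S)"
proof -
  have pS: "pos_on S h" using W S unfolding pos_on_def by blast
  obtain B where B: "orthonormal_basis h S B" using orthonormal_basis_exists[OF pS S(1)] .
  have "(\<Sum>a\<in>A. h (orth_proj h S a) a) = (\<Sum>b\<in>B. h (orth_proj h W b) b)"
    by (rule trace_orth_proj_symmetric[OF W pS S(1) A B])
  also have "\<dots> = (\<Sum>b\<in>B. 1)"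
    using orthonormal_basisD[OF B] S W by (intro sum.cong) (auto simp: orth_proj_id)
  finally show ?thesis using orthonormal_basis_card[OF B] by simp
qed

text \<open>
  The residual of the projection onto \<open>S\<close> is the projection onto the complement of \<open>S\<close> in \<open>W\<close>, so its
  trace does not depend on the form.
\<close>

lemma trace_residual:
  assumes W: "pos_on W h" "subspace W" and S: "subspace S" "S \<subseteq> W" and A: "orthonormal_basis h W A"
  shows "(\<Sum>a\<in>A. Re (h (a - orth_proj h S a) a)) = real (dim W) - real (dim S)"
proof -
  have "(\<Sum>a\<in>A. h (a - orth_proj h S a) a) = (\<Sum>a\<in>A. h a a) - (\<Sum>a\<in>A. h (orth_proj h S a) a)"
    by (simp add: form_diff_left sum_subtractf)
  also have "(\<Sum>a\<in>A. h a a) = (\<Sum>a\<in>A. 1)"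
    using orthonormal_basisD[OF A] by (intro sum.cong) auto
  finally have "(\<Sum>a\<in>A. h (a - orth_proj h S a) a) = of_nat (dim W) - of_nat (dim S)"
    using trace_orth_proj[OF assms] orthonormal_basis_card[OF A] by simp
  from arg_cong[OF this, of Re] show ?thesis by simp
qed

end

section \<open>Constructions and estimates for Hermitian forms\<close>

lemma hermitian_form_add:
  assumes "hermitian_form f" "hermitian_form g"
  shows "hermitian_form (\<lambda>x y. f x y + g x y)"
proof (rule hermitian_formI)
  fix x y show "f y x + g y x = cnj (f x y + g x y)"
    using form_cnj[OF assms(1), of y x] form_cnj[OF assms(2), of y x] by simp
qed (simp_all add: form_add_left[OF assms(1)] form_add_left[OF assms(2)]
    form_scale_left[OF assms(1)] form_scale_left[OF assms(2)] algebra_simps)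

lemma hermitian_form_diff:
  assumes "hermitian_form f" "hermitian_form g"
  shows "hermitian_form (\<lambda>x y. f x y - g x y)"
proof (rule hermitian_formI)
  fix x y show "f y x - g y x = cnj (f x y - g x y)"
    using form_cnj[OF assms(1), of y x] form_cnj[OF assms(2), of y x] by simp
qed (simp_all add: form_add_left[OF assms(1)] form_add_left[OF assms(2)]
    form_scale_left[OF assms(1)] form_scale_left[OF assms(2)] algebra_simps)

lemma hermitian_form_pullback:
  assumes "hermitian_form f" "\<And>x y. P (x + y) = P x + P y" "\<And>c x. P (c *s x) = c *s P x"
  shows "hermitian_form (\<lambda>x y. f (P x) (P y))"
proof (rule hermitian_formI)
  fix x y show "f (P y) (P x) = cnj (f (P x) (P y))"
    by (rule form_cnj[OF assms(1)])
qed (simp_all add: form_add_left[OF assms(1)] form_scale_left[OF assms(1)] assms)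

lemma hermitian_form_limit:
  assumes f: "\<And>k::nat. hermitian_form (f k)" and lim: "\<And>x y. (\<lambda>k. f k x y) \<longlonglongrightarrow> g x y"
  shows "hermitian_form g"
proof (rule hermitian_formI)
  fix x y z c
  have "(\<lambda>k. f k (x + y) z) \<longlonglongrightarrow> g x z + g y z"
    unfolding form_add_left[OF f] by (intro tendsto_add lim)
  then show "g (x + y) z = g x z + g y z" using LIMSEQ_unique lim by blast
  have "(\<lambda>k. f k (c *s x) y) \<longlonglongrightarrow> c * g x y"
    unfolding form_scale_left[OF f] by (intro tendsto_intros lim)
  then show "g (c *s x) y = c * g x y" using LIMSEQ_unique lim by blast
  have "(\<lambda>k. cnj (f k x y)) \<longlonglongrightarrow> cnj (g x y)" by (intro tendsto_intros lim)
  moreover have "(\<lambda>k. cnj (f k x y)) = (\<lambda>k. f k y x)" by (rule ext) (rule form_cnj[OF f, symmetric])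
  ultimately show "g y x = cnj (g x y)" using LIMSEQ_unique lim by metis
qed

text \<open>
  A semidefinite form is dominated by its trace times \<open>h\<close>. The constant is far from sharp, but only its
  independence of \<open>g\<close> and \<open>x\<close> matters.
\<close>

lemma form_diag_le_trace:
  assumes h: "hermitian_form h" and B: "orthonormal_basis h W B"
    and g: "hermitian_form g" and psd: "psd_on W g" and x: "x \<in> W"
  shows "Re (g x x) \<le> (real (card B))\<^sup>2 * (\<Sum>b\<in>B. Re (g b b)) * Re (h x x)"
proof -
  note Bp = orthonormal_basisD[OF h B]
  define t where "t = (\<Sum>b\<in>B. Re (g b b))"
  have nonneg: "0 \<le> Re (g b b)" if "b \<in> B" for b
    using psd Bp that unfolding psd_on_def by blast
  have le_t: "Re (g b b) \<le> t" if "b \<in> B" for b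
    unfolding t_def using Bp nonneg that by (intro member_le_sum) auto
  have entry: "cmod (g a b) \<le> t" if "a \<in> B" "b \<in> B" for a b
  proof -
    have "a \<in> W" "b \<in> W" using that Bp by auto
    then have "2 * cmod (g a b) \<le> Re (g a a) + Re (g b b)"
      using Bp by (intro psd_entry_le[OF g _ psd]) auto
    then show ?thesis using le_t[OF that(1)] le_t[OF that(2)] by linarith
  qed
  have t0: "0 \<le> t" unfolding t_def by (intro sum_nonneg nonneg)
  have "h x x = (\<Sum>b\<in>B. h x b * h b x)" by (rule orthonormal_parseval[OF h B x])
  also have "\<dots> = (\<Sum>b\<in>B. complex_of_real ((cmod (h x b))\<^sup>2))"
    by (intro sum.cong refl) (metis form_cnj[OF h] complex_norm_square)
  finally have "Re (h x x) = (\<Sum>b\<in>B. (cmod (h x b))\<^sup>2)"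
    by (metis Re_complex_of_real of_real_sum)
  then have coef: "(cmod (h x b))\<^sup>2 \<le> Re (h x x)" if "b \<in> B" for b
    using Bp that by (metis member_le_sum[of b B "\<lambda>b. (cmod (h x b))\<^sup>2"] zero_le_power2)
  have coef2: "cmod (h x a) * cmod (h x b) \<le> Re (h x x)" if "a \<in> B" "b \<in> B" for a b
    using sum_squares_bound[of "cmod (h x a)" "cmod (h x b)"] coef[OF that(1)] coef[OF that(2)]
    by simp
  have "g x x = g (\<Sum>a\<in>B. h x a *s a) (\<Sum>b\<in>B. h x b *s b)"
    using orthonormal_expand[OF h B x] by simp
  also have "\<dots> = (\<Sum>a\<in>B. h x a * g a (\<Sum>b\<in>B. h x b *s b))"
    by (simp only: form_sum_left[OF g] form_scale_left[OF g])
  also have "\<dots> = (\<Sum>a\<in>B. \<Sum>b\<in>B. h x a * (cnj (h x b) * g a b))"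
    by (simp only: form_sum_right[OF g] form_scale_right[OF g] sum_distrib_left)
  finally have gxx: "g x x = (\<Sum>a\<in>B. \<Sum>b\<in>B. h x a * (cnj (h x b) * g a b))" .
  have "Re (g x x) \<le> cmod (g x x)" by (rule complex_Re_le_cmod)
  also have "\<dots> \<le> (\<Sum>a\<in>B. \<Sum>b\<in>B. cmod (h x a * (cnj (h x b) * g a b)))"
    unfolding gxx by (intro order_trans[OF norm_sum] sum_mono norm_sum)
  also have "\<dots> \<le> (\<Sum>a\<in>B. \<Sum>b\<in>B. Re (h x x) * t)"
  proof (intro sum_mono)
    fix a b assume ab: "a \<in> B" "b \<in> B"
    have "cmod (h x a) * cmod (h x b) * cmod (g a b) \<le> Re (h x x) * t"
      using coef2[OF ab] entry[OF ab] order_trans[OF zero_le_power2 coef[OF ab(1)]]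
      by (intro mult_mono) auto
    then show "cmod (h x a * (cnj (h x b) * g a b)) \<le> Re (h x x) * t"
      by (simp add: norm_mult mult.assoc)
  qed
  also have "\<dots> = (real (card B))\<^sup>2 * t * Re (h x x)" by (simp add: power2_eq_square)
  finally show ?thesis unfolding t_def .
qed

lemma pos_on_imp_psd_on: "hermitian_form h \<Longrightarrow> pos_on S h \<Longrightarrow> psd_on S h"
  unfolding pos_on_def psd_on_def by (metis form_zero_left less_imp_le order_refl zero_complex.sel(1))

lemma pos_on_subset: "pos_on S h \<Longrightarrow> T \<subseteq> S \<Longrightarrow> pos_on T h"
  unfolding pos_on_def by blast

text \<open>
  The form that makes the given basis orthonormal.
\<close>

lemma hermitian_metric_exists: "\<exists>h. hermitian_form h \<and> pos_on UNIV h"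
proof -
  define h where "h x y = (\<Sum>b\<in>Basis. representation Basis x b * cnj (representation Basis y b))" for x y
  have rep: "x \<in> span Basis" for x using span_Basis by simp
  have "hermitian_form h"
  proof (rule hermitian_formI)
    fix x y z c
    show "h (x + y) z = h x z + h y z"
      by (simp add: h_def representation_add[OF independent_Basis rep rep] sum.distrib algebra_simps)
    show "h (c *s x) y = c * h x y"
      by (simp add: h_def representation_scale[OF independent_Basis rep] sum_distrib_left mult.assoc)
    show "h y x = cnj (h x y)" by (simp add: h_def mult.commute)
  qed
  moreover have "pos_on UNIV h"
    unfolding pos_on_def
  proof (intro ballI impI)
    fix x :: 'v assume "x \<noteq> 0"
    have e: "(\<Sum>b\<in>Basis. representation Basis x b *s b) = x"
      by (rule sum_representation_eq[OF independent_Basis rep finite_Basis order_refl])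
    have "\<exists>b\<in>Basis. representation Basis x b \<noteq> 0"
    proof (rule ccontr)
      assume "\<not> ?thesis"
      then have "(\<Sum>b\<in>Basis. representation Basis x b *s b) = 0" by simp
      with e \<open>x \<noteq> 0\<close> show False by simp
    qed
    then obtain b where b: "b \<in> Basis" "representation Basis x b \<noteq> 0" by blast
    have "h x x = complex_of_real (\<Sum>b\<in>Basis. (cmod (representation Basis x b))\<^sup>2)"
      unfolding h_def by (simp only: complex_norm_square of_real_sum)
    then have "Re (h x x) = (\<Sum>b\<in>Basis. (cmod (representation Basis x b))\<^sup>2)"
      by (simp only: Re_complex_of_real)
    also have "\<dots> > 0" using b finite_Basis
      by (intro sum_pos2[of _ b]) auto
    finally show "0 < Re (h x x)" .
  qed
  ultimately show ?thesis by blast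
qed

lemma radical_subspace:
  assumes Q: "hermitian_form Q" and W: "subspace W" and psd: "psd_on W Q"
  shows "subspace {x \<in> W. Re (Q x x) = 0}"
proof (rule subspaceI)
  show "0 \<in> {x \<in> W. Re (Q x x) = 0}" using W by (simp add: subspace_0 form_zero_left[OF Q])
next
  fix x y assume "x \<in> {x \<in> W. Re (Q x x) = 0}" "y \<in> {x \<in> W. Re (Q x x) = 0}"
  then have x: "x \<in> W" "Re (Q x x) = 0" and y: "y \<in> W" "Re (Q y y) = 0" by auto
  have "Re (Q (x + y) (x + y)) = Re (Q x x) + Re (Q y y)"
    by (rule form_pythagoras[OF Q psd_null[OF Q W psd x(1) y]])
  then show "x + y \<in> {x \<in> W. Re (Q x x) = 0}"
    using x y subspace_add[OF W x(1) y(1)] by simp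
next
  fix c x assume "x \<in> {x \<in> W. Re (Q x x) = 0}"
  then show "c *s x \<in> {x \<in> W. Re (Q x x) = 0}"
    using subspace_scale[OF W, of x c] by (simp only: mem_Collect_eq form_diag_scale[OF Q]) simp
qed

section \<open>Weighted squared distances and the radical of a limit form\<close>

text \<open>
  For positive \<open>h\<close> this is the operator \<open>T\<close> of the introduction: its value at \<open>(x, x)\<close> is the sum of
  the weighted squared distances from \<open>x\<close> to the \<open>V i\<close>, see \<open>residual_form_diag\<close>. The projection appears in
  only one slot, which makes linearity evident.
\<close>

definition residual_form ::
    "nat \<Rightarrow> (nat \<Rightarrow> real) \<Rightarrow> (nat \<Rightarrow> 'v set) \<Rightarrow> ('v \<Rightarrow> 'v \<Rightarrow> complex) \<Rightarrow> 'v \<Rightarrow> 'v \<Rightarrow> complex" where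
  "residual_form m w V h x y =
    (\<Sum>i = 1..m. complex_of_real (w i) * h (x - orth_proj h (V i) x) y)"

text \<open>
  Adding \<open>h\<close> in every step makes the sequence increasing and keeps all its terms positive definite.
\<close>

primrec residual_iteration ::
    "nat \<Rightarrow> (nat \<Rightarrow> real) \<Rightarrow> (nat \<Rightarrow> 'v set) \<Rightarrow> ('v \<Rightarrow> 'v \<Rightarrow> complex) \<Rightarrow> nat \<Rightarrow> 'v \<Rightarrow> 'v \<Rightarrow> complex" where
  "residual_iteration m w V h 0 = h"
| "residual_iteration m w V h (Suc k) =
    (\<lambda>x y. residual_form m w V (residual_iteration m w V h k) x y + h x y)"

lemma hermitian_residual_form:
  assumes h: "hermitian_form h" and V: "\<And>i. i \<in> {1..m} \<Longrightarrow> subspace (V i) \<and> pos_on (V i) h"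
  shows "hermitian_form (residual_form m w V h)"
proof (rule hermitian_formI)
  fix x y z c
  have 1: "h ((x + y) - orth_proj h (V i) (x + y)) z
      = h (x - orth_proj h (V i) x) z + h (y - orth_proj h (V i) y) z" if "i \<in> {1..m}" for i
    using V[OF that] orth_proj_add[OF h, of "V i" x y]
    by (simp add: form_add_left[OF h] form_diff_left[OF h])
  show "residual_form m w V h (x + y) z = residual_form m w V h x z + residual_form m w V h y z"
    unfolding residual_form_def sum.distrib[symmetric] distrib_left[symmetric]
    by (rule sum.cong[OF refl]) (simp only: 1)
  have 2: "h (c *s x - orth_proj h (V i) (c *s x)) z
      = c * h (x - orth_proj h (V i) x) z" if "i \<in> {1..m}" for i
    using V[OF that] orth_proj_scale[OF h, of "V i" c x]
    by (simp add: form_scale_left[OF h] form_diff_left[OF h] right_diff_distrib)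
  show "residual_form m w V h (c *s x) z = c * residual_form m w V h x z"
    unfolding residual_form_def sum_distrib_left mult.left_commute[of c]
    by (rule sum.cong[OF refl]) (simp only: 2)
  have 3: "h (y - orth_proj h (V i) y) x = cnj (h (x - orth_proj h (V i) x) y)" if "i \<in> {1..m}" for i
  proof -
    have "h (orth_proj h (V i) y) x = h y (orth_proj h (V i) x)"
      using V[OF that] orth_proj_self_adjoint[OF h] by blast
    then show ?thesis
      using form_cnj[OF h, of y "orth_proj h (V i) x"] form_cnj[OF h, of y x]
      by (simp add: form_diff_left[OF h])
  qed
  show "residual_form m w V h y x = cnj (residual_form m w V h x y)"
    unfolding residual_form_def cnj_sum complex_cnj_mult complex_cnj_complex_of_real
    by (rule sum.cong[OF refl]) (simp only: 3)
qed

lemma residual_form_diag: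
  assumes h: "hermitian_form h" and V: "\<And>i. i \<in> {1..m} \<Longrightarrow> subspace (V i) \<and> pos_on (V i) h"
  shows "Re (residual_form m w V h x x)
    = (\<Sum>i = 1..m. w i * Re (h (x - orth_proj h (V i) x) (x - orth_proj h (V i) x)))"
proof -
  have 1: "h (x - orth_proj h (V i) x) x = h (x - orth_proj h (V i) x) (x - orth_proj h (V i) x)"
    if "i \<in> {1..m}" for i
    using V[OF that] orth_proj_residual_diag[OF h] by metis
  show ?thesis unfolding residual_form_def Re_sum
    by (rule sum.cong[OF refl]) (simp add: 1[simplified])
qed

text \<open>
  The trace, in \<open>W / N\<close>, of the inequality \<open>Q \<le> T Q\<close>: on the quotient \<open>Q\<close> is positive definite, the image
  of \<open>V i\<close> is \<open>(V i + N) / N\<close>, and the residuals of the projections have trace \<open>dim W - dim (V i + N)\<close>.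
  Instead of forming the quotient, the proof extends \<open>Q\<close> to a positive form by an auxiliary metric on \<open>N\<close>.
\<close>

lemma radical_codim_le:
  assumes W: "subspace W" and V: "\<And>i. i \<in> {1..m} \<Longrightarrow> subspace (V i) \<and> V i \<subseteq> W"
    and w: "\<And>i. i \<in> {1..m} \<Longrightarrow> 0 \<le> w i"
    and Q: "hermitian_form Q" "psd_on W Q"
    and sub: "\<And>x \<eta>. x \<in> W \<Longrightarrow> (\<And>i. i \<in> {1..m} \<Longrightarrow> \<eta> i \<in> V i) \<Longrightarrow>
      Re (Q x x) \<le> (\<Sum>i = 1..m. w i * Re (Q (x - \<eta> i) (x - \<eta> i)))"
  defines "N \<equiv> {x \<in> W. Re (Q x x) = 0}"
  shows "real (dim W) - real (dim N)
    \<le> (\<Sum>i = 1..m. w i * (real (dim W) - real (dim {x + y |x y. x \<in> V i \<and> y \<in> N})))"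
proof -
  obtain g where g: "hermitian_form g" "pos_on UNIV g" using hermitian_metric_exists by blast
  have N: "subspace N" unfolding N_def by (rule radical_subspace[OF Q(1) W Q(2)])
  have NW: "N \<subseteq> W" by (auto simp: N_def)
  have null: "Q x y = 0" if "x \<in> W" "y \<in> N" for x y
    using that psd_null[OF Q(1) W Q(2)] by (auto simp: N_def)
  have gN: "pos_on N g" using g pos_on_subset by blast
  define P where "P = orth_proj g N"
  note P_mem = orth_proj_mem[OF g(1) gN N, folded P_def]
  note P_id = orth_proj_id[OF g(1) gN N, folded P_def]
  note P_add = orth_proj_add[OF g(1) gN N, folded P_def]
  note P_scale = orth_proj_scale[OF g(1) gN N, folded P_def]
  have P_diff: "P (x - P x) = 0" for x
  proof -
    have "P x = P ((x - P x) + P x)" by simp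
    also have "\<dots> = P (x - P x) + P x" by (simp only: P_add P_id[OF P_mem])
    finally show ?thesis by (simp only: add_cancel_right_left)
  qed
  \<comment> \<open>the radical becomes orthogonal to its \<open>g\<close>-complement, on which \<open>h\<close> agrees with \<open>Q\<close>\<close>
  define h where "h x y = Q x y + g (P x) (P y)" for x y
  have h: "hermitian_form h"
    unfolding h_def by (rule hermitian_form_add[OF Q(1) hermitian_form_pullback[OF g(1) P_add P_scale]])
  have gP: "0 \<le> Re (g (P x) (P x))" for x
    using pos_on_imp_psd_on[OF g] by (simp add: psd_on_def)
  have Qh: "Re (Q x x) \<le> Re (h x x)" for x using gP[of x] by (simp add: h_def)
  have pos: "pos_on W h"
    unfolding pos_on_def
  proof (intro ballI impI)
    fix x assume x: "x \<in> W" "x \<noteq> 0"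
    show "0 < Re (h x x)"
    proof (cases "x \<in> N")
      case True
      then have "Re (Q x x) = 0" "P x = x" using P_id by (auto simp: N_def)
      then show ?thesis using g x by (simp add: h_def pos_on_def)
    next
      case False
      then have "Re (Q x x) \<noteq> 0" "0 \<le> Re (Q x x)"
        using x Q by (auto simp: N_def psd_on_def)
      then show ?thesis using gP[of x] by (simp add: h_def)
    qed
  qed
  obtain C where C: "orthonormal_basis h W C" using orthonormal_basis_exists[OF h pos W] .
  note Cp = orthonormal_basisD[OF h C]
  \<comment> \<open>the projections onto \<open>N\<close> for \<open>g\<close> and for \<open>h\<close> agree, so \<open>Q\<close> is the residual form of \<open>N\<close> for \<open>h\<close>\<close>
  have PN: "orth_proj h N x = P x" if x: "x \<in> W" for x
  proof (rule orth_projI[OF h pos_on_subset[OF pos NW] N P_mem])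
    fix s assume s: "s \<in> N"
    have "x - P x \<in> W" using x P_mem NW W by (auto intro: subspace_diff)
    then show "h (x - P x) s = 0"
      using null[OF _ s] by (simp add: h_def P_diff form_zero_left[OF g(1)])
  qed
  have hP: "h (P x) x = g (P x) (P x)" if x: "x \<in> W" for x
  proof -
    have "Q (P x) x = 0" using null[OF x P_mem] form_zero_commute[OF Q(1)] by blast
    then show ?thesis by (simp add: h_def P_id[OF P_mem])
  qed
  have traceQ: "(\<Sum>c\<in>C. Re (Q c c)) = real (dim W) - real (dim N)"
  proof -
    have "(\<Sum>c\<in>C. Re (Q c c)) = (\<Sum>c\<in>C. Re (h (c - orth_proj h N c) c))"
    proof (rule sum.cong[OF refl])
      fix c assume "c \<in> C"
      then have "c \<in> W" using Cp by blast
      then show "Re (Q c c) = Re (h (c - orth_proj h N c) c)"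
        by (simp add: PN form_diff_left[OF h] hP) (simp add: h_def)
    qed
    also have "\<dots> = real (dim W) - real (dim N)"
      by (rule trace_residual[OF h pos W N NW C])
    finally show ?thesis .
  qed
  define S where "S i = {x + y |x y. x \<in> V i \<and> y \<in> N}" for i
  have S: "subspace (S i)" "S i \<subseteq> W" if "i \<in> {1..m}" for i
    using V[OF that] N NW W subspace_sums[of "V i" N]
    by (auto simp: S_def intro!: subspace_add)
  have le: "Re (Q c c) \<le> (\<Sum>i = 1..m. w i * Re (h (c - orth_proj h (S i) c) c))" if c: "c \<in> C" for c
  proof -
    have cW: "c \<in> W" using c Cp by blast
    have "\<forall>i\<in>{1..m}. \<exists>v. v \<in> V i \<and> (\<exists>y\<in>N. orth_proj h (S i) c = v + y)"
    proof
      fix i assume i: "i \<in> {1..m}"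
      have "orth_proj h (S i) c \<in> S i"
        by (rule orth_proj_mem[OF h pos_on_subset[OF pos S(2)[OF i]] S(1)[OF i]])
      then show "\<exists>v. v \<in> V i \<and> (\<exists>y\<in>N. orth_proj h (S i) c = v + y)" unfolding S_def by blast
    qed
    then obtain \<eta> where \<eta>: "\<And>i. i \<in> {1..m} \<Longrightarrow> \<eta> i \<in> V i \<and> (\<exists>y\<in>N. orth_proj h (S i) c = \<eta> i + y)"
      using bchoice[of "{1..m}" "\<lambda>i v. v \<in> V i \<and> (\<exists>y\<in>N. orth_proj h (S i) c = v + y)"] by blast
    have "Re (Q c c) \<le> (\<Sum>i = 1..m. w i * Re (Q (c - \<eta> i) (c - \<eta> i)))"
      using \<eta> by (intro sub cW) blast
    also have "\<dots> \<le> (\<Sum>i = 1..m. w i * Re (h (c - orth_proj h (S i) c) c))"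
    proof (intro sum_mono mult_left_mono w)
      fix i assume i: "i \<in> {1..m}"
      define p where "p = orth_proj h (S i) c"
      obtain y where y: "y \<in> N" "p = \<eta> i + y" using \<eta>[OF i] unfolding p_def by blast
      have pS: "p \<in> S i" unfolding p_def
        by (rule orth_proj_mem[OF h pos_on_subset[OF pos S(2)[OF i]] S(1)[OF i]])
      have cp: "c - p \<in> W" using cW pS S(2)[OF i] W by (auto intro: subspace_diff)
      \<comment> \<open>moving within \<open>N\<close> does not change \<open>Q\<close>, so the point of \<open>V i\<close> does as well as the point of \<open>S i\<close>\<close>
      have "Re (Q ((c - p) + y) ((c - p) + y)) = Re (Q (c - p) (c - p)) + Re (Q y y)"
        by (rule form_pythagoras[OF Q(1) null[OF cp y(1)]])
      moreover have "Re (Q y y) = 0" using y by (simp add: N_def)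
      moreover have "(c - p) + y = c - \<eta> i" using y by simp
      ultimately have "Re (Q (c - \<eta> i) (c - \<eta> i)) = Re (Q (c - p) (c - p))" by simp
      also have "\<dots> \<le> Re (h (c - p) (c - p))" by (rule Qh)
      also have "h (c - p) (c - p) = h (c - p) c" unfolding p_def
        by (rule orth_proj_residual_diag[OF h pos_on_subset[OF pos S(2)[OF i]] S(1)[OF i]])
      finally show "Re (Q (c - \<eta> i) (c - \<eta> i)) \<le> Re (h (c - orth_proj h (S i) c) c)"
        unfolding p_def .
    qed
    finally show ?thesis .
  qed
  have "real (dim W) - real (dim N) \<le> (\<Sum>c\<in>C. \<Sum>i = 1..m. w i * Re (h (c - orth_proj h (S i) c) c))"
    unfolding traceQ[symmetric] by (intro sum_mono le)
  also have "\<dots> = (\<Sum>i = 1..m. w i * (\<Sum>c\<in>C. Re (h (c - orth_proj h (S i) c) c)))"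
    by (subst sum.swap) (simp only: sum_distrib_left)
  also have "\<dots> = (\<Sum>i = 1..m. w i * (real (dim W) - real (dim (S i))))"
    using trace_residual[OF h pos W S C] by (intro sum.cong refl) metis
  finally show ?thesis unfolding S_def .
qed

section \<open>Stable configurations and the distance iteration\<close>

context
  fixes m :: nat and w :: "nat \<Rightarrow> real" and V :: "nat \<Rightarrow> 'v set" and W :: "'v set"
  assumes W: "subspace W"
    and V: "\<And>i. i \<in> {1..m} \<Longrightarrow> subspace (V i) \<and> V i \<subseteq> W"
    and w: "\<And>i. i \<in> {1..m} \<Longrightarrow> 0 \<le> w i"
begin

text \<open>
  A squared distance is the minimum over all points of \<open>V i\<close>. In this form, linear in \<open>h\<close> on the right, the
  inequality survives passing to limits that are no longer positive definite.
\<close>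

lemma residual_form_le:
  assumes h: "hermitian_form h" "pos_on W h" and x: "x \<in> W" and \<eta>: "\<And>i. i \<in> {1..m} \<Longrightarrow> \<eta> i \<in> V i"
  shows "Re (residual_form m w V h x x) \<le> (\<Sum>i = 1..m. w i * Re (h (x - \<eta> i) (x - \<eta> i)))"
proof -
  have Vh: "subspace (V i) \<and> pos_on (V i) h" if "i \<in> {1..m}" for i
    using V[OF that] pos_on_subset[OF h(2)] by blast
  have eq: "Re (residual_form m w V h x x)
      = (\<Sum>i = 1..m. w i * Re (h (x - orth_proj h (V i) x) (x - orth_proj h (V i) x)))"
    by (rule residual_form_diag[OF h(1) Vh])
  show ?thesis unfolding eq
  proof (intro sum_mono mult_left_mono w)
    fix i assume i: "i \<in> {1..m}"
    show "Re (h (x - orth_proj h (V i) x) (x - orth_proj h (V i) x)) \<le> Re (h (x - \<eta> i) (x - \<eta> i))"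
      using Vh[OF i] V[OF i] \<eta>[OF i]
      by (intro orth_proj_minimal[OF h(1) _ _ W pos_on_imp_psd_on[OF h]]) auto
  qed
qed

lemma residual_form_nonneg:
  assumes h: "hermitian_form h" "pos_on W h" and x: "x \<in> W"
  shows "0 \<le> Re (residual_form m w V h x x)"
proof -
  have Vh: "subspace (V i) \<and> pos_on (V i) h" if "i \<in> {1..m}" for i
    using V[OF that] pos_on_subset[OF h(2)] by blast
  have eq: "Re (residual_form m w V h x x)
      = (\<Sum>i = 1..m. w i * Re (h (x - orth_proj h (V i) x) (x - orth_proj h (V i) x)))"
    by (rule residual_form_diag[OF h(1) Vh])
  show ?thesis unfolding eq
  proof (intro sum_nonneg mult_nonneg_nonneg w)
    fix i assume i: "i \<in> {1..m}"
    have "orth_proj h (V i) x \<in> W" using orth_proj_mem[OF h(1)] Vh[OF i] V[OF i] by blast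
    then have "x - orth_proj h (V i) x \<in> W" using W x by (simp add: subspace_diff)
    then show "0 \<le> Re (h (x - orth_proj h (V i) x) (x - orth_proj h (V i) x))"
      using pos_on_imp_psd_on[OF h] unfolding psd_on_def by blast
  qed
qed

text \<open>
  The projections for the larger form are competitors for the smaller one.
\<close>

lemma residual_form_mono:
  assumes f: "hermitian_form f" "pos_on W f" and g: "hermitian_form g" "pos_on W g"
    and le: "\<And>x. x \<in> W \<Longrightarrow> Re (f x x) \<le> Re (g x x)" and x: "x \<in> W"
  shows "Re (residual_form m w V f x x) \<le> Re (residual_form m w V g x x)"
proof -
  have Vg: "subspace (V i) \<and> pos_on (V i) g" if "i \<in> {1..m}" for i
    using V[OF that] pos_on_subset[OF g(2)] by blast
  have mem: "orth_proj g (V i) x \<in> V i" if "i \<in> {1..m}" for i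
    using orth_proj_mem[OF g(1)] Vg[OF that] by blast
  have "Re (residual_form m w V f x x)
      \<le> (\<Sum>i = 1..m. w i * Re (f (x - orth_proj g (V i) x) (x - orth_proj g (V i) x)))"
    by (rule residual_form_le[OF f x mem])
  also have "\<dots> \<le> (\<Sum>i = 1..m. w i * Re (g (x - orth_proj g (V i) x) (x - orth_proj g (V i) x)))"
  proof (intro sum_mono mult_left_mono w le)
    fix i assume i: "i \<in> {1..m}"
    show "x - orth_proj g (V i) x \<in> W" using mem[OF i] V[OF i] W x by (auto intro: subspace_diff)
  qed
  also have "\<dots> = Re (residual_form m w V g x x)"
    by (rule residual_form_diag[symmetric, OF g(1) Vg])
  finally show ?thesis .
qed

text \<open>
  The trace of \<open>T h\<close> relative to \<open>h\<close> depends only on dimensions.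
\<close>

lemma trace_residual_form:
  assumes h: "hermitian_form h" "pos_on W h" and C: "orthonormal_basis h W C"
  shows "(\<Sum>c\<in>C. Re (residual_form m w V h c c)) = (\<Sum>i = 1..m. w i * (real (dim W) - real (dim (V i))))"
proof -
  have tr: "(\<Sum>c\<in>C. Re (h (c - orth_proj h (V i) c) c)) = real (dim W) - real (dim (V i))"
    if "i \<in> {1..m}" for i
    using trace_residual[OF h W _ _ C] V[OF that] by blast
  have "(\<Sum>c\<in>C. Re (residual_form m w V h c c))
      = (\<Sum>c\<in>C. \<Sum>i = 1..m. w i * Re (h (c - orth_proj h (V i) c) c))"
    unfolding residual_form_def by simp
  also have "\<dots> = (\<Sum>i = 1..m. w i * (\<Sum>c\<in>C. Re (h (c - orth_proj h (V i) c) c)))"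
    by (subst sum.swap) (simp only: sum_distrib_left)
  also have "\<dots> = (\<Sum>i = 1..m. w i * (real (dim W) - real (dim (V i))))"
    by (rule sum.cong[OF refl]) (simp only: tr)
  finally show ?thesis .
qed

context
  fixes h :: "'v \<Rightarrow> 'v \<Rightarrow> complex"
  assumes h: "hermitian_form h" and hpos: "pos_on UNIV h"
begin

private abbreviation "R \<equiv> residual_iteration m w V h"

lemma residual_iteration_basic:
  "hermitian_form (R k) \<and> (\<forall>x\<in>W. Re (h x x) \<le> Re (R k x x)) \<and> pos_on W (R k)"
proof (induction k)
  case 0
  then show ?case using h pos_on_subset[OF hpos] by auto
next
  case (Suc k)
  then have f: "hermitian_form (R k)" "pos_on W (R k)" by auto
  have "subspace (V i) \<and> pos_on (V i) (R k)" if "i \<in> {1..m}" for i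
    using V[OF that] pos_on_subset[OF f(2)] by blast
  from hermitian_form_add[OF hermitian_residual_form[of "R k" m V w, OF f(1) this] h]
  have 1: "hermitian_form (R (Suc k))" by (simp only: residual_iteration.simps)
  have 2: "Re (h x x) \<le> Re (R (Suc k) x x)" if "x \<in> W" for x
    using residual_form_nonneg[OF f that] by simp
  have "pos_on W (R (Suc k))"
    using 2 hpos unfolding pos_on_def by (meson UNIV_I less_le_trans)
  with 1 2 show ?case by blast
qed

lemma residual_iteration_hermitian: "hermitian_form (R k)"
  and residual_iteration_ge: "x \<in> W \<Longrightarrow> Re (h x x) \<le> Re (R k x x)"
  and residual_iteration_pos: "pos_on W (R k)"
  using residual_iteration_basic by blast+

lemma residual_iteration_mono: "x \<in> W \<Longrightarrow> Re (R k x x) \<le> Re (R (Suc k) x x)"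
proof (induction k arbitrary: x)
  case 0
  then show ?case using residual_iteration_ge[of x "Suc 0"] by simp
next
  case (Suc k)
  have "Re (residual_form m w V (R k) x x) \<le> Re (residual_form m w V (R (Suc k)) x x)"
    by (rule residual_form_mono[OF residual_iteration_hermitian residual_iteration_pos
          residual_iteration_hermitian residual_iteration_pos Suc])
  then show ?case by simp
qed

text \<open>
  If the traces stayed bounded, their increments would tend to zero, and some step would raise the form
  by at most \<open>\<delta> h\<close> with \<open>\<delta> < 1\<close>. As that step replaces \<open>R k\<close> by \<open>T (R k) + h\<close>, the form \<open>T (R k)\<close> would
  be smaller than \<open>R k\<close> by at least the positive amount \<open>(1 - \<delta>) h\<close>, although it has the same trace relative to \<open>R k\<close>.
\<close>

lemma residual_iteration_unbounded:
  assumes W0: "W \<noteq> {0}" and B: "orthonormal_basis h W B"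
    and norm: "(\<Sum>i = 1..m. w i * (real (dim W) - real (dim (V i)))) = real (dim W)"
  shows "filterlim (\<lambda>k. \<Sum>b\<in>B. Re (R k b b)) at_top sequentially"
proof -
  define t where "t k = (\<Sum>b\<in>B. Re (R k b b))" for k
  note Bp = orthonormal_basisD[OF h B]
  have inc: "incseq t" unfolding t_def
    by (intro incseq_SucI sum_mono residual_iteration_mono subsetD[OF Bp(3)])
  have unb: "\<exists>k. C < t k" for C
  proof (rule ccontr)
    assume "\<not> ?thesis"
    then have "\<And>k. t k \<le> C" by (simp add: not_less)
    then obtain l where l: "t \<longlonglongrightarrow> l" using incseq_convergent[OF inc] by blast
    have "(\<lambda>k. (real (card B))\<^sup>2 * (t (Suc k) - t k)) \<longlonglongrightarrow> (real (card B))\<^sup>2 * (l - l)"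
      by (intro tendsto_intros l LIMSEQ_Suc)
    then have "\<forall>\<^sub>F k in sequentially. (real (card B))\<^sup>2 * (t (Suc k) - t k) < 1"
      by (rule order_tendstoD) simp
    then obtain k where k: "(real (card B))\<^sup>2 * (t (Suc k) - t k) < 1"
      using eventually_happens'[OF sequentially_bot] by blast
    \<comment> \<open>bounds the increment of the form by \<open>form_diag_le_trace\<close>\<close>
    define \<delta> where "\<delta> = (real (card B))\<^sup>2 * (t (Suc k) - t k)"
    define g where "g x y = R (Suc k) x y - R k x y" for x y
    have g: "hermitian_form g" unfolding g_def
      by (rule hermitian_form_diff[OF residual_iteration_hermitian residual_iteration_hermitian])
    have gpsd: "psd_on W g" unfolding psd_on_def g_def
      using residual_iteration_mono by simp
    have step: "Re (residual_form m w V (R k) x x) + (1 - \<delta>) * Re (h x x) \<le> Re (R k x x)"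
      if x: "x \<in> W" for x
    proof -
      have "Re (g x x) \<le> (real (card B))\<^sup>2 * (\<Sum>b\<in>B. Re (g b b)) * Re (h x x)"
        by (rule form_diag_le_trace[OF h B g gpsd x])
      also have "(\<Sum>b\<in>B. Re (g b b)) = t (Suc k) - t k"
        by (simp only: g_def t_def minus_complex.sel sum_subtractf)
      finally have "Re (g x x) \<le> \<delta> * Re (h x x)" unfolding \<delta>_def .
      then show ?thesis by (simp add: g_def algebra_simps)
    qed
    obtain C where C: "orthonormal_basis (R k) W C"
      using orthonormal_basis_exists[OF residual_iteration_hermitian residual_iteration_pos W] .
    note Cp = orthonormal_basisD[OF residual_iteration_hermitian C]
    have "(\<Sum>c\<in>C. Re (residual_form m w V (R k) c c) + (1 - \<delta>) * Re (h c c)) \<le> (\<Sum>c\<in>C. Re (R k c c))"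
      using Cp by (intro sum_mono step) auto
    also have "\<dots> = (\<Sum>c\<in>C. 1)" using Cp by (intro sum.cong) auto
    also have "\<dots> = real (dim W)"
      using orthonormal_basis_card[OF residual_iteration_hermitian C] by simp
    finally have "(1 - \<delta>) * (\<Sum>c\<in>C. Re (h c c)) \<le> 0"
      unfolding sum.distrib sum_distrib_left[symmetric]
        trace_residual_form[OF residual_iteration_hermitian residual_iteration_pos C] norm
      by simp
    moreover have "0 < (\<Sum>c\<in>C. Re (h c c))"
    proof (rule sum_pos)
      show "C \<noteq> {}" using W0 Cp(2) by auto
      show "0 < Re (h c c)" if "c \<in> C" for c
      proof -
        have "c \<noteq> 0" using Cp(5)[OF that that] form_zero_left[OF residual_iteration_hermitian] by auto
        then show ?thesis using hpos by (simp add: pos_on_def)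
      qed
    qed (use Cp in simp)
    ultimately show False using k unfolding \<delta>_def by (simp add: mult_le_0_iff)
  qed
  show ?thesis unfolding t_def[symmetric] filterlim_at_top
  proof
    fix Z
    obtain k where "Z < t k" using unb by blast
    then have "Z \<le> t n" if "k \<le> n" for n using incseqD[OF inc that] by simp
    then show "\<forall>\<^sub>F n in sequentially. Z \<le> t n" unfolding eventually_sequentially by blast
  qed
qed

text \<open>
  The form \<open>Q\<close> is a limit point of the iterates divided by their traces \<open>t k\<close>. Monotonicity gives
  \<open>R k - h \<le> T (R k)\<close>, and \<open>h / t k\<close> tends to zero. The limit may be degenerate, so its projections need
  not exist; this is why the conclusion speaks of arbitrary points \<open>\<eta> i\<close> of \<open>V i\<close>.
\<close>

lemma residual_subsolution_exists:
  assumes W0: "W \<noteq> {0}"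
    and norm: "(\<Sum>i = 1..m. w i * (real (dim W) - real (dim (V i)))) = real (dim W)"
  shows "\<exists>Q. hermitian_form Q \<and> psd_on W Q \<and> (\<exists>x\<in>W. Re (Q x x) \<noteq> 0) \<and>
    (\<forall>x\<in>W. \<forall>\<eta>. (\<forall>i\<in>{1..m}. \<eta> i \<in> V i) \<longrightarrow>
      Re (Q x x) \<le> (\<Sum>i = 1..m. w i * Re (Q (x - \<eta> i) (x - \<eta> i))))"
proof -
  have hW: "pos_on W h" using pos_on_subset[OF hpos] by blast
  obtain B where B: "orthonormal_basis h W B" using orthonormal_basis_exists[OF h hW W] .
  note Bp = orthonormal_basisD[OF h B]
  define t where "t k = (\<Sum>b\<in>B. Re (R k b b))" for k
  have t_lim: "filterlim t at_top sequentially"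
    unfolding t_def by (rule residual_iteration_unbounded[OF W0 B norm])
  have psd: "psd_on W (R k)" for k
    by (rule pos_on_imp_psd_on[OF residual_iteration_hermitian residual_iteration_pos])
  have nonneg: "0 \<le> Re (R k b b)" if "b \<in> B" for k b
    using psd[of k] Bp that unfolding psd_on_def by blast
  have le_t: "Re (R k b b) \<le> t k" if "b \<in> B" for k b
    unfolding t_def using Bp nonneg that by (intro member_le_sum) auto
  have t_pos: "0 < t k" for k
  proof -
    have "B \<noteq> {}" using W0 Bp(2) by auto
    have "0 < (\<Sum>b\<in>B. Re (h b b))" using Bp \<open>B \<noteq> {}\<close> by (intro sum_pos) auto
    also have "\<dots> \<le> t k" unfolding t_def by (intro sum_mono residual_iteration_ge subsetD[OF Bp(3)])
    finally show ?thesis .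
  qed
  \<comment> \<open>matrix entries of the normalized iterates, bounded because the trace dominates them\<close>
  define e where "e k ab = R k (fst ab) (snd ab) / complex_of_real (t k)" for k ab
  have e_bound: "cmod (e k ab) \<le> 1" if mem: "ab \<in> B \<times> B" for k ab
  proof -
    obtain a b where ab: "ab = (a, b)" "a \<in> B" "b \<in> B" using mem by blast
    have "2 * cmod (R k a b) \<le> Re (R k a a) + Re (R k b b)"
      by (rule psd_entry_le[OF residual_iteration_hermitian W psd subsetD[OF Bp(3) ab(2)] subsetD[OF Bp(3) ab(3)]])
    then have "cmod (R k a b) \<le> t k" using le_t[OF ab(2), of k] le_t[OF ab(3), of k] by linarith
    then show ?thesis using t_pos[of k] by (simp add: e_def ab(1) norm_divide)
  qed
  obtain r L where r: "strict_mono r" and L: "\<And>ab. ab \<in> B \<times> B \<Longrightarrow> (\<lambda>k. e (r k) ab) \<longlonglongrightarrow> L ab"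
    using finite_family_convergent_subseq[of "B \<times> B" e 1] e_bound Bp(1) by blast
  define P where "P = orth_proj h W"
  have P_mem: "P x \<in> W" for x unfolding P_def by (rule orth_proj_mem[OF h hW W])
  have P_id: "P x = x" if "x \<in> W" for x unfolding P_def by (rule orth_proj_id[OF h hW W that])
  \<comment> \<open>precomposing with the projection onto \<open>W\<close> makes the limit exist for all arguments, not only in \<open>W\<close>\<close>
  define F where "F k x y = R (r k) (P x) (P y) / complex_of_real (t (r k))" for k x y
  have F_herm: "hermitian_form (F k)" for k
  proof -
    have "hermitian_form (\<lambda>x y. R (r k) (P x) (P y))"
      unfolding P_def
      by (rule hermitian_form_pullback[OF residual_iteration_hermitian
            orth_proj_add[OF h hW W] orth_proj_scale[OF h hW W]])
    note G = form_add_left[OF this] form_scale_left[OF this] form_cnj[OF this]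
    show ?thesis
    proof (rule hermitian_formI)
      fix x y z c
      show "F k (x + y) z = F k x z + F k y z" by (simp only: F_def G(1) add_divide_distrib)
      show "F k (c *s x) y = c * F k x y" by (simp only: F_def G(2) times_divide_eq_right)
      show "F k y x = cnj (F k x y)"
        unfolding F_def complex_cnj_divide complex_cnj_complex_of_real G(3)[of y x] ..
    qed
  qed
  have F_expand: "F k x y = (\<Sum>a\<in>B. \<Sum>b\<in>B. h (P x) a * (cnj (h (P y) b) * e (r k) (a, b)))" for k x y
  proof -
    note g = residual_iteration_hermitian[of "r k"]
    have "R (r k) (P x) (P y) = R (r k) (\<Sum>a\<in>B. h (P x) a *s a) (\<Sum>b\<in>B. h (P y) b *s b)"
      using orthonormal_expand[OF h B P_mem] by simp
    also have "\<dots> = (\<Sum>a\<in>B. h (P x) a * R (r k) a (\<Sum>b\<in>B. h (P y) b *s b))"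
      by (simp only: form_sum_left[OF g] form_scale_left[OF g])
    also have "\<dots> = (\<Sum>a\<in>B. \<Sum>b\<in>B. h (P x) a * (cnj (h (P y) b) * R (r k) a b))"
      by (simp only: form_sum_right[OF g] form_scale_right[OF g] sum_distrib_left)
    finally show ?thesis
      by (simp only: F_def e_def sum_divide_distrib times_divide_eq_right fst_conv snd_conv)
  qed
  define Q where "Q x y = (\<Sum>a\<in>B. \<Sum>b\<in>B. h (P x) a * (cnj (h (P y) b) * L (a, b)))" for x y
  have F_lim: "(\<lambda>k. F k x y) \<longlonglongrightarrow> Q x y" for x y
    unfolding F_expand Q_def by (intro tendsto_intros L) auto
  have F_lim_Re: "(\<lambda>k. Re (F k x y)) \<longlonglongrightarrow> Re (Q x y)" for x y
    by (intro tendsto_intros F_lim)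
  have Re_F: "Re (F k x x) = Re (R (r k) x x) / t (r k)" if "x \<in> W" for k x
    by (simp add: F_def P_id[OF that])
  have Q: "hermitian_form Q" by (rule hermitian_form_limit[OF F_herm F_lim])
  have "psd_on W Q"
    unfolding psd_on_def
  proof
    fix x assume x: "x \<in> W"
    have "0 \<le> Re (F k x x)" for k
      using psd[of "r k"] t_pos[of "r k"] x by (simp add: Re_F[OF x] psd_on_def)
    then show "0 \<le> Re (Q x x)" by (intro LIMSEQ_le_const[OF F_lim_Re]) blast
  qed
  moreover have "\<exists>x\<in>W. Re (Q x x) \<noteq> 0"
  proof (rule ccontr)
    assume "\<not> ?thesis"
    then have zero: "(\<Sum>b\<in>B. Re (Q b b)) = 0" using Bp(3) by (intro sum.neutral) blast
    have "(\<Sum>b\<in>B. Re (F k b b)) = 1" for k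
    proof -
      have "(\<Sum>b\<in>B. Re (F k b b)) = (\<Sum>b\<in>B. Re (R (r k) b b) / t (r k))"
        by (intro sum.cong refl Re_F subsetD[OF Bp(3)])
      also have "\<dots> = t (r k) / t (r k)" by (simp only: t_def sum_divide_distrib)
      finally show ?thesis using t_pos[of "r k"] by simp
    qed
    moreover have "(\<lambda>k. \<Sum>b\<in>B. Re (F k b b)) \<longlonglongrightarrow> (\<Sum>b\<in>B. Re (Q b b))"
      by (intro tendsto_sum F_lim_Re)
    ultimately show False using zero by (simp add: LIMSEQ_const_iff)
  qed
  moreover have "Re (Q x x) \<le> (\<Sum>i = 1..m. w i * Re (Q (x - \<eta> i) (x - \<eta> i)))"
    if x: "x \<in> W" and \<eta>: "\<forall>i\<in>{1..m}. \<eta> i \<in> V i" for x \<eta>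
  proof (rule LIMSEQ_le)
    have "filterlim (\<lambda>k. t (r k)) at_top sequentially"
      using filterlim_compose[OF t_lim filterlim_subseq[OF r]] .
    then have "(\<lambda>k. Re (h x x) / t (r k)) \<longlonglongrightarrow> 0"
      by (intro tendsto_divide_0[OF tendsto_const] filterlim_at_top_imp_at_infinity)
    from tendsto_diff[OF F_lim_Re this]
    show "(\<lambda>k. Re (F k x x) - Re (h x x) / t (r k)) \<longlonglongrightarrow> Re (Q x x)" by simp
    show "(\<lambda>k. \<Sum>i = 1..m. w i * Re (F k (x - \<eta> i) (x - \<eta> i)))
        \<longlonglongrightarrow> (\<Sum>i = 1..m. w i * Re (Q (x - \<eta> i) (x - \<eta> i)))"
      by (intro tendsto_intros F_lim)
    have xW: "x - \<eta> i \<in> W" if "i \<in> {1..m}" for i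
      using \<eta> V[OF that] that W x by (auto intro!: subspace_diff)
    have "Re (F k x x) - Re (h x x) / t (r k) \<le> (\<Sum>i = 1..m. w i * Re (F k (x - \<eta> i) (x - \<eta> i)))" for k
    proof -
      have "Re (R (r k) x x) - Re (h x x) \<le> Re (residual_form m w V (R (r k)) x x)"
        using residual_iteration_mono[OF x, of "r k"] by simp
      also have "\<dots> \<le> (\<Sum>i = 1..m. w i * Re (R (r k) (x - \<eta> i) (x - \<eta> i)))"
        using \<eta> by (intro residual_form_le[OF residual_iteration_hermitian residual_iteration_pos x]) blast
      finally have "(Re (R (r k) x x) - Re (h x x)) / t (r k)
          \<le> (\<Sum>i = 1..m. w i * Re (R (r k) (x - \<eta> i) (x - \<eta> i))) / t (r k)"
        using t_pos[of "r k"] by (intro divide_right_mono) auto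
      also have "\<dots> = (\<Sum>i = 1..m. w i * Re (F k (x - \<eta> i) (x - \<eta> i)))"
        unfolding sum_divide_distrib times_divide_eq_right[symmetric]
        by (rule sum.cong[OF refl]) (simp only: Re_F[OF xW])
      finally show ?thesis by (simp only: Re_F[OF x] diff_divide_distrib)
    qed
    then show "\<exists>N. \<forall>k\<ge>N. Re (F k x x) - Re (h x x) / t (r k)
        \<le> (\<Sum>i = 1..m. w i * Re (F k (x - \<eta> i) (x - \<eta> i)))" by blast
  qed
  ultimately show ?thesis using Q by blast
qed

end

text \<open>
  The hypothesis \<open>stab\<close> is stability, rewritten in terms of codimensions for weights normalized by
  \<open>norm\<close>. It excludes a radical of the limit form, after which equality of traces promotes \<open>Q \<le> T Q\<close> to an
  equality.
\<close>

theorem stable_imp_residual_fixed_point: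
  assumes norm: "(\<Sum>i = 1..m. w i * (real (dim W) - real (dim (V i)))) = real (dim W)"
    and stab: "\<And>N. subspace N \<Longrightarrow> N \<noteq> {0} \<Longrightarrow> N \<subset> W \<Longrightarrow>
      real (dim N) < (\<Sum>i = 1..m. w i * (real (dim N) - real (dim (V i \<inter> N))))"
  shows "\<exists>h. hermitian_form h \<and> pos_on W h \<and>
    (\<forall>x\<in>W. (\<Sum>i = 1..m. complex_of_real (w i) *s (x - orth_proj h (V i) x)) = x)"
proof (cases "W = {0}")
  case True
  obtain h where h: "hermitian_form h" "pos_on UNIV h" using hermitian_metric_exists by blast
  have "orth_proj h (V i) 0 = 0" if "i \<in> {1..m}" for i
    using orth_proj_id[OF h(1) pos_on_subset[OF h(2)], of "V i" 0] V[OF that] subspace_0 by blast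
  then have "(\<Sum>i = 1..m. complex_of_real (w i) *s (0 - orth_proj h (V i) 0)) = 0"
    by (intro sum.neutral) simp
  then show ?thesis using h True pos_on_subset[OF h(2)] by (intro exI[of _ h]) auto
next
  case False
  obtain h where h: "hermitian_form h" "pos_on UNIV h" using hermitian_metric_exists by blast
  obtain Q where Q: "hermitian_form Q" "psd_on W Q" "\<exists>x\<in>W. Re (Q x x) \<noteq> 0"
    and sub: "\<forall>x\<in>W. \<forall>\<eta>. (\<forall>i\<in>{1..m}. \<eta> i \<in> V i) \<longrightarrow>
      Re (Q x x) \<le> (\<Sum>i = 1..m. w i * Re (Q (x - \<eta> i) (x - \<eta> i)))"
    using residual_subsolution_exists[OF h False norm] by blast
  define N where "N = {x \<in> W. Re (Q x x) = 0}"
  have N: "subspace N" unfolding N_def by (rule radical_subspace[OF Q(1) W Q(2)])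
  have NW: "N \<subset> W" using Q(3) by (auto simp: N_def)
  have N0: "N = {0}"
  proof (rule ccontr)
    assume "N \<noteq> {0}"
    have "real (dim W) - real (dim N)
        \<le> (\<Sum>i = 1..m. w i * (real (dim W) - real (dim {x + y |x y. x \<in> V i \<and> y \<in> N})))"
      unfolding N_def using sub by (intro radical_codim_le[OF W V w Q(1,2)]) blast+
    also have "\<dots> = (\<Sum>i = 1..m. w i * (real (dim W) - real (dim (V i))) -
        w i * (real (dim N) - real (dim (V i \<inter> N))))"
    proof (rule sum.cong[OF refl])
      fix i assume i: "i \<in> {1..m}"
      have "real (dim {x + y |x y. x \<in> V i \<and> y \<in> N})
          = real (dim (V i)) + real (dim N) - real (dim (V i \<inter> N))"
        using dim_sums_Int[of "V i" N] V[OF i] N by linarith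
      then show "w i * (real (dim W) - real (dim {x + y |x y. x \<in> V i \<and> y \<in> N}))
          = w i * (real (dim W) - real (dim (V i))) - w i * (real (dim N) - real (dim (V i \<inter> N)))"
        by (simp only: right_diff_distrib[symmetric]) simp
    qed
    also have "\<dots> = real (dim W) - (\<Sum>i = 1..m. w i * (real (dim N) - real (dim (V i \<inter> N))))"
      by (simp only: sum_subtractf norm)
    finally show False using stab[OF N \<open>N \<noteq> {0}\<close> NW] by linarith
  qed
  have pos: "pos_on W Q" unfolding pos_on_def
  proof (intro ballI impI)
    fix x assume x: "x \<in> W" "x \<noteq> 0"
    then have "x \<notin> N" using N0 by blast
    then show "0 < Re (Q x x)" using x Q(2) unfolding N_def psd_on_def by force
  qed
  have VQ: "subspace (V i) \<and> pos_on (V i) Q" if "i \<in> {1..m}" for i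
    using V[OF that] pos_on_subset[OF pos] by blast
  have mem: "orth_proj Q (V i) x \<in> V i" if "i \<in> {1..m}" for i x
    using orth_proj_mem[OF Q(1)] VQ[OF that] by blast
  \<comment> \<open>a semidefinite form of trace zero vanishes\<close>
  define g where "g x y = residual_form m w V Q x y - Q x y" for x y
  have g: "hermitian_form g" unfolding g_def
    by (rule hermitian_form_diff[OF hermitian_residual_form[OF Q(1) VQ] Q(1)])
  have gpsd: "psd_on W g" unfolding psd_on_def
  proof
    fix x assume x: "x \<in> W"
    have "Re (Q x x) \<le> (\<Sum>i = 1..m. w i *
        Re (Q (x - orth_proj Q (V i) x) (x - orth_proj Q (V i) x)))"
      by (rule sub[rule_format, OF x mem])
    also have "\<dots> = Re (residual_form m w V Q x x)"
      by (rule residual_form_diag[symmetric, OF Q(1) VQ])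
    finally show "0 \<le> Re (g x x)" by (simp add: g_def)
  qed
  obtain C where C: "orthonormal_basis Q W C" using orthonormal_basis_exists[OF Q(1) pos W] .
  note Cp = orthonormal_basisD[OF Q(1) C]
  have "(\<Sum>c\<in>C. Re (g c c)) = (\<Sum>c\<in>C. Re (residual_form m w V Q c c)) - (\<Sum>c\<in>C. Re (Q c c))"
    by (simp only: g_def minus_complex.sel sum_subtractf)
  also have "(\<Sum>c\<in>C. Re (Q c c)) = (\<Sum>c\<in>C. 1)" using Cp by (intro sum.cong) auto
  also have "(\<Sum>c\<in>C. Re (residual_form m w V Q c c)) - (\<Sum>c\<in>C. 1) = 0"
    using trace_residual_form[OF Q(1) pos C] norm orthonormal_basis_card[OF Q(1) C] by simp
  finally have tr0: "(\<Sum>c\<in>C. Re (g c c)) = 0" .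
  have diag0: "Re (g x x) = 0" if "x \<in> W" for x
    using form_diag_le_trace[OF Q(1) C g gpsd that] gpsd that unfolding tr0 psd_on_def by force
  have "(\<Sum>i = 1..m. complex_of_real (w i) *s (x - orth_proj Q (V i) x)) = x" if x: "x \<in> W" for x
  proof -
    define u where "u = (\<Sum>i = 1..m. complex_of_real (w i) *s (x - orth_proj Q (V i) x)) - x"
    have xp: "x - orth_proj Q (V i) x \<in> W" if "i \<in> {1..m}" for i
      using mem[OF that, of x] V[OF that] W x by (auto intro: subspace_diff)
    have uW: "u \<in> W" unfolding u_def
      by (rule subspace_diff[OF W subspace_sum[OF W subspace_scale[OF W xp]] x])
    have "Q u u = g x u"
      unfolding g_def residual_form_def
      by (subst u_def) (simp only: form_diff_left[OF Q(1), of _ x] form_sum_left[OF Q(1)] form_scale_left[OF Q(1)])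
    also have "\<dots> = 0" by (rule psd_null[OF g W gpsd x uW diag0[OF uW]])
    finally have "u = 0" using pos uW unfolding pos_on_def by force
    then show ?thesis unfolding u_def by simp
  qed
  then show ?thesis using Q(1) pos by blast
qed

end

section \<open>From a balance metric to stable orthogonal summands\<close>

context
  fixes h :: "'v \<Rightarrow> 'v \<Rightarrow> complex"
  assumes h: "hermitian_form h" and pos: "pos_on UNIV h"
begin

lemma pos_on_any: "pos_on S h"
  using pos_on_subset[OF pos] by blast

lemma form_diag_zero: "h x x = 0 \<Longrightarrow> x = 0"
  using pos by (force simp: pos_on_def)

text \<open>
  By symmetry of the trace, sum over an orthonormal basis of \<open>S\<close> that extends one of \<open>S \<inter> K\<close>. The vectors
  in \<open>S \<inter> K\<close> contribute \<open>1\<close> each and the others a squared length; in the case of equality the others are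
  orthogonal to \<open>K\<close>, so that \<open>S\<close> splits along \<open>K\<close> and its complement.
\<close>

lemma trace_compression_ge:
  assumes S: "subspace S" and K: "subspace K" and B: "orthonormal_basis h K B"
  shows "real (dim (S \<inter> K)) \<le> (\<Sum>b\<in>B. Re (h (orth_proj h S b) b))"
    and "real (dim (S \<inter> K)) = (\<Sum>b\<in>B. Re (h (orth_proj h S b) b)) \<longleftrightarrow> orth_proj h S ` K \<subseteq> K"
proof -
  have SK: "subspace (S \<inter> K)" using S K by (rule subspace_inter)
  obtain A' where A': "orthonormal_basis h (S \<inter> K) A'"
    using orthonormal_basis_exists[OF h pos_on_any SK] .
  obtain A where A: "A' \<subseteq> A" "orthonormal_basis h S A"
    using orthonormal_basis_extend[OF h pos_on_any S A'] by blast
  note Ap = orthonormal_basisD[OF h A(2)] and A'p = orthonormal_basisD[OF h A']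
  have "(\<Sum>b\<in>B. h (orth_proj h S b) b) = (\<Sum>a\<in>A. h (orth_proj h K a) a)"
    by (rule trace_orth_proj_symmetric[OF h pos_on_any K pos_on_any S B A(2)])
  then have "Re (\<Sum>b\<in>B. h (orth_proj h S b) b) = Re (\<Sum>a\<in>A. h (orth_proj h K a) a)" by simp
  then have "(\<Sum>b\<in>B. Re (h (orth_proj h S b) b)) = (\<Sum>a\<in>A. Re (h (orth_proj h K a) a))"
    by (simp only: Re_sum)
  also have "\<dots> = (\<Sum>a\<in>A - A'. Re (h (orth_proj h K a) a)) + (\<Sum>a\<in>A'. Re (h (orth_proj h K a) a))"
    by (rule sum.subset_diff[OF A(1) Ap(1)])
  also have "(\<Sum>a\<in>A'. Re (h (orth_proj h K a) a)) = (\<Sum>a\<in>A'. 1)"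
  proof (rule sum.cong[OF refl])
    fix a assume a: "a \<in> A'"
    then have "orth_proj h K a = a" using A'p(3) orth_proj_id[OF h pos_on_any K] by blast
    then show "Re (h (orth_proj h K a) a) = 1" using A'p(5)[OF a a] by simp
  qed
  also have "\<dots> = real (dim (S \<inter> K))" using orthonormal_basis_card[OF h A'] by simp
  finally have split: "(\<Sum>b\<in>B. Re (h (orth_proj h S b) b))
    = (\<Sum>a\<in>A - A'. Re (h (orth_proj h K a) a)) + real (dim (S \<inter> K))" .
  have nonneg: "0 \<le> Re (h (orth_proj h K a) a)" for a
    using pos_on_imp_psd_on[OF h pos] orth_proj_diag[OF h pos_on_any K, of a]
    by (simp add: psd_on_def)
  show "real (dim (S \<inter> K)) \<le> (\<Sum>b\<in>B. Re (h (orth_proj h S b) b))"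
    unfolding split by (simp only: le_add_same_cancel2) (intro sum_nonneg nonneg)
  show "real (dim (S \<inter> K)) = (\<Sum>b\<in>B. Re (h (orth_proj h S b) b)) \<longleftrightarrow> orth_proj h S ` K \<subseteq> K"
  proof
    assume "real (dim (S \<inter> K)) = (\<Sum>b\<in>B. Re (h (orth_proj h S b) b))"
    then have "(\<Sum>a\<in>A - A'. Re (h (orth_proj h K a) a)) = 0" using split by simp
    then have z: "Re (h (orth_proj h K a) a) = 0" if "a \<in> A - A'" for a
      using sum_nonneg_eq_0_iff[of "A - A'" "\<lambda>a. Re (h (orth_proj h K a) a)"] nonneg Ap(1) that by auto
    have pK: "orth_proj h K a = 0" if "a \<in> A - A'" for a
    proof (rule form_diag_zero)
      have "Re (h (orth_proj h K a) (orth_proj h K a)) = 0"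
        using z[OF that] orth_proj_diag[OF h pos_on_any K, of a] by simp
      then show "h (orth_proj h K a) (orth_proj h K a) = 0" by (metis form_diag_real[OF h] of_real_0)
    qed
    show "orth_proj h S ` K \<subseteq> K"
    proof (rule image_subsetI)
      fix x assume x: "x \<in> K"
      have "h x a *s a \<in> K" if a: "a \<in> A" for a
      proof (cases "a \<in> A'")
        case True
        then show ?thesis using A'p(3) K by (auto intro: subspace_scale)
      next
        case False
        have "h x a = h (orth_proj h K x) a" using orth_proj_id[OF h pos_on_any K x] by simp
        also have "\<dots> = h x (orth_proj h K a)" by (rule orth_proj_self_adjoint[OF h pos_on_any K])
        also have "\<dots> = 0" using pK a False form_zero_right[OF h] by simp
        finally show ?thesis using subspace_0[OF K] by simp
      qed
      then show "orth_proj h S x \<in> K"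
        unfolding orth_proj_expand[OF h pos_on_any S A(2)] by (intro subspace_sum[OF K])
    qed
  next
    assume inv: "orth_proj h S ` K \<subseteq> K"
    have "orth_proj h (S \<inter> K) b = orth_proj h S b" if "b \<in> B" for b
    proof (rule orth_projI[OF h pos_on_any SK])
      have "b \<in> K" using that orthonormal_basisD(3)[OF h B] by blast
      then show "orth_proj h S b \<in> S \<inter> K"
        using inv orth_proj_mem[OF h pos_on_any S] by blast
      show "h (b - orth_proj h S b) s = 0" if "s \<in> S \<inter> K" for s
        using orth_proj_residual[OF h pos_on_any S] that by blast
    qed
    then have "(\<Sum>b\<in>B. h (orth_proj h S b) b) = (\<Sum>b\<in>B. h (orth_proj h (S \<inter> K) b) b)" by simp
    also have "\<dots> = of_nat (dim (S \<inter> K))"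
      by (rule trace_orth_proj[OF h pos_on_any K SK _ B]) simp
    finally have "Re (\<Sum>b\<in>B. h (orth_proj h S b) b) = real (dim (S \<inter> K))" by simp
    then show "real (dim (S \<inter> K)) = (\<Sum>b\<in>B. Re (h (orth_proj h S b) b))" by (simp only: Re_sum)
  qed
qed

lemma orthogonal_direct_sum:
  assumes U: "subspace U" and H: "\<And>q. q \<in> {1..l} \<Longrightarrow> subspace (H q) \<and> H q \<subseteq> U"
    and orth: "\<And>q r x y. q \<in> {1..l} \<Longrightarrow> r \<in> {1..l} \<Longrightarrow> q \<noteq> r \<Longrightarrow> x \<in> H q \<Longrightarrow> y \<in> H r \<Longrightarrow> h x y = 0"
    and span: "\<And>x. x \<in> U \<Longrightarrow> \<exists>y. (\<forall>q\<in>{1..l}. y q \<in> H q) \<and> x = (\<Sum>q = 1..l. y q)"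
  shows "direct_sum U l H"
  unfolding direct_sum_def
proof (intro conjI ballI bij_betw_imageI)
  show "subspace (H q)" if "q \<in> {1..l}" for q using H[OF that] by blast
  show "inj_on (\<lambda>x. \<Sum>q = 1..l. x q) (\<Pi>\<^sub>E q\<in>{1..l}. H q)"
  proof (rule inj_onI)
    fix x y assume x: "x \<in> (\<Pi>\<^sub>E q\<in>{1..l}. H q)" and y: "y \<in> (\<Pi>\<^sub>E q\<in>{1..l}. H q)"
      and eq: "(\<Sum>q = 1..l. x q) = (\<Sum>q = 1..l. y q)"
    have d: "x q - y q \<in> H q" if "q \<in> {1..l}" for q
      using PiE_mem[OF x that] PiE_mem[OF y that] H[OF that] by (auto intro: subspace_diff)
    show "x = y"
    proof (rule PiE_ext[OF x y])
      fix r assume r: "r \<in> {1..l}"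
      have "0 = h (\<Sum>q = 1..l. x q - y q) (x r - y r)"
        by (simp only: sum_subtractf eq diff_self form_zero_left[OF h])
      also have "\<dots> = (\<Sum>q = 1..l. h (x q - y q) (x r - y r))" by (rule form_sum_left[OF h])
      also have "\<dots> = (\<Sum>q = 1..l. if q = r then h (x r - y r) (x r - y r) else 0)"
        by (rule sum.cong[OF refl]) (use orth d r in auto)
      also have "\<dots> = h (x r - y r) (x r - y r)" using r by simp
      finally show "x r = y r" using form_diag_zero[of "x r - y r"] by simp
    qed
  qed
  show "(\<lambda>x. \<Sum>q = 1..l. x q) ` (\<Pi>\<^sub>E q\<in>{1..l}. H q) = U"
  proof (rule set_eqI, rule iffI)
    fix u assume "u \<in> (\<lambda>x. \<Sum>q = 1..l. x q) ` (\<Pi>\<^sub>E q\<in>{1..l}. H q)"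
    then obtain x where x: "x \<in> (\<Pi>\<^sub>E q\<in>{1..l}. H q)" "u = (\<Sum>q = 1..l. x q)" by blast
    show "u \<in> U" unfolding x(2) by (intro subspace_sum[OF U]) (use PiE_mem[OF x(1)] H in blast)
  next
    fix u assume "u \<in> U"
    then obtain y where y: "\<forall>q\<in>{1..l}. y q \<in> H q" "u = (\<Sum>q = 1..l. y q)" using span by blast
    have "restrict y {1..l} \<in> (\<Pi>\<^sub>E q\<in>{1..l}. H q)" using y by auto
    moreover have "u = (\<Sum>q = 1..l. restrict y {1..l} q)" unfolding y(2) by (intro sum.cong) auto
    ultimately show "u \<in> (\<lambda>x. \<Sum>q = 1..l. x q) ` (\<Pi>\<^sub>E q\<in>{1..l}. H q)" by blast
  qed
qed

context
  fixes m :: nat and V :: "nat \<Rightarrow> 'v set"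
  assumes V: "\<And>i. i \<in> {1..m} \<Longrightarrow> subspace (V i)"
begin

definition invariant_subspace :: "'v set \<Rightarrow> bool" where
  "invariant_subspace K \<longleftrightarrow> subspace K \<and> (\<forall>i\<in>{1..m}. orth_proj h (V i) ` K \<subseteq> K)"

definition irreducible_subspace :: "'v set \<Rightarrow> bool" where
  "irreducible_subspace K \<longleftrightarrow> invariant_subspace K \<and> K \<noteq> {0} \<and>
    (\<forall>L. invariant_subspace L \<and> L \<noteq> {0} \<and> L \<subseteq> K \<longrightarrow> L = K)"

lemma invariant_subspace_UNIV: "invariant_subspace UNIV"
  by (simp add: invariant_subspace_def)

text \<open>
  Take an invariant subspace of least positive dimension.
\<close>

lemma irreducible_subspace_exists:
  assumes W: "invariant_subspace W" "W \<noteq> {0}"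
  obtains K where "irreducible_subspace K" "K \<subseteq> W"
proof -
  define P where "P K \<longleftrightarrow> invariant_subspace K \<and> K \<noteq> {0} \<and> K \<subseteq> W" for K
  have "P W" using W by (simp add: P_def)
  then obtain K where K: "P K" and min: "\<And>L. P L \<Longrightarrow> dim K \<le> dim L"
    using ex_has_least_nat[of P W dim] by blast
  have "L = K" if L: "invariant_subspace L" "L \<noteq> {0}" "L \<subseteq> K" for L
  proof (rule subspace_dim_equal[OF _ _ L(3)])
    have "P L" using L K unfolding P_def by blast
    then show "dim K \<le> dim L" by (rule min)
  qed (use L K in \<open>simp_all add: P_def invariant_subspace_def\<close>)
  then have "irreducible_subspace K" using K unfolding irreducible_subspace_def P_def by blast
  then show thesis using that K unfolding P_def by blast
qed

text \<open>
  This is where self-adjointness of the projections enters.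
\<close>

lemma invariant_orthogonal_complement:
  assumes W: "invariant_subspace W" and K: "invariant_subspace K"
  shows "invariant_subspace {x \<in> W. \<forall>y\<in>K. h x y = 0}"
  unfolding invariant_subspace_def
proof (intro conjI ballI image_subsetI)
  have sW: "subspace W" using W by (simp add: invariant_subspace_def)
  show "subspace {x \<in> W. \<forall>y\<in>K. h x y = 0}"
    by (rule subspaceI)
      (simp_all add: subspace_0[OF sW] subspace_add[OF sW] subspace_scale[OF sW]
        form_zero_left[OF h] form_add_left[OF h] form_scale_left[OF h])
  fix i x assume i: "i \<in> {1..m}" and x: "x \<in> {x \<in> W. \<forall>y\<in>K. h x y = 0}"
  have "h (orth_proj h (V i) x) y = 0" if y: "y \<in> K" for y
  proof -
    have "orth_proj h (V i) y \<in> K" using K i y unfolding invariant_subspace_def by blast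
    then show ?thesis
      using x orth_proj_self_adjoint[OF h pos_on_any V[OF i], of x y] by simp
  qed
  then show "orth_proj h (V i) x \<in> {x \<in> W. \<forall>y\<in>K. h x y = 0}"
    using W i x unfolding invariant_subspace_def by blast
qed

definition orthogonal_irreducible_sum :: "nat \<Rightarrow> (nat \<Rightarrow> 'v set) \<Rightarrow> 'v set \<Rightarrow> bool" where
  "orthogonal_irreducible_sum l H W \<longleftrightarrow>
    (\<forall>q\<in>{1..l}. irreducible_subspace (H q) \<and> H q \<subseteq> W) \<and>
    (\<forall>q\<in>{1..l}. \<forall>r\<in>{1..l}. q \<noteq> r \<longrightarrow> (\<forall>x\<in>H q. \<forall>y\<in>H r. h x y = 0)) \<and>
    (\<forall>x\<in>W. \<exists>y. (\<forall>q\<in>{1..l}. y q \<in> H q) \<and> x = (\<Sum>q = 1..l. y q))"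

text \<open>
  Split off an irreducible subspace and continue in its orthogonal complement.
\<close>

lemma irreducible_decomposition:
  assumes "invariant_subspace W"
  shows "\<exists>l H. orthogonal_irreducible_sum l H W"
  using assms
proof (induction "dim W" arbitrary: W rule: less_induct)
  case less
  show ?case
  proof (cases "W = {0}")
    case True
    then have "orthogonal_irreducible_sum 0 H W" for H by (simp add: orthogonal_irreducible_sum_def)
    then show ?thesis by blast
  next
    case False
    obtain K where K: "irreducible_subspace K" "K \<subseteq> W"
      using irreducible_subspace_exists[OF less.prems False] by blast
    have Kinv: "invariant_subspace K" and K0: "K \<noteq> {0}"
      using K by (auto simp: irreducible_subspace_def)
    have sK: "subspace K" and sW: "subspace W"
      using Kinv less.prems by (auto simp: invariant_subspace_def)
    define W' where "W' = {x \<in> W. \<forall>y\<in>K. h x y = 0}"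
    have W': "invariant_subspace W'" unfolding W'_def
      by (rule invariant_orthogonal_complement[OF less.prems Kinv])
    have sW': "subspace W'" using W' by (simp add: invariant_subspace_def)
    have W'W: "W' \<subseteq> W" by (auto simp: W'_def)
    obtain z where z: "z \<in> K" "z \<noteq> 0" using K0 subspace_0[OF sK] by blast
    then have "z \<notin> W'" using form_diag_zero[of z] by (auto simp: W'_def)
    with z K(2) W'W have "W' \<subset> W" by blast
    then have "dim W' < dim W" 
      using dim_psubset[of W' W] by (simp only: span_eq_iff[THEN iffD2, OF sW] span_eq_iff[THEN iffD2, OF sW'])
    from less.hyps[OF this W'] obtain l H where "orthogonal_irreducible_sum l H W'" by blast
    then have H: "\<forall>q\<in>{1..l}. irreducible_subspace (H q) \<and> H q \<subseteq> W'"
      and orth: "\<forall>q\<in>{1..l}. \<forall>r\<in>{1..l}. q \<noteq> r \<longrightarrow> (\<forall>x\<in>H q. \<forall>y\<in>H r. h x y = 0)"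
      and span: "\<forall>x\<in>W'. \<exists>y. (\<forall>q\<in>{1..l}. y q \<in> H q) \<and> x = (\<Sum>q = 1..l. y q)"
      unfolding orthogonal_irreducible_sum_def by simp_all
    define G where "G = H(Suc l := K)"
    have G1: "G q = H q" if "q \<in> {1..l}" for q using that by (simp add: G_def)
    have G2: "G (Suc l) = K" by (simp add: G_def)
    have split: "q \<in> {1..l} \<or> q = Suc l" if "q \<in> {1..Suc l}" for q using that by auto
    have cross: "h x y = 0" "h y x = 0" if "q \<in> {1..l}" "x \<in> H q" "y \<in> K" for q x y
    proof -
      have "x \<in> W'" using that H by blast
      then show "h x y = 0" using that(3) by (simp add: W'_def)
      then show "h y x = 0" using form_zero_commute[OF h] by blast
    qed
    have "\<forall>q\<in>{1..Suc l}. irreducible_subspace (G q) \<and> G q \<subseteq> W"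
      using H K W'W G1 G2 split by (metis order_trans)
    moreover have "h x y = 0"
      if q: "q \<in> {1..Suc l}" and r: "r \<in> {1..Suc l}" and "q \<noteq> r" "x \<in> G q" "y \<in> G r" for q r x y
      using split[OF q] split[OF r] that orth cross G1 G2 by metis
    moreover have "\<exists>y. (\<forall>q\<in>{1..Suc l}. y q \<in> G q) \<and> x = (\<Sum>q = 1..Suc l. y q)" if x: "x \<in> W" for x
    proof -
      define p where "p = orth_proj h K x"
      have p: "p \<in> K" unfolding p_def by (rule orth_proj_mem[OF h pos_on_any sK])
      have "x - p \<in> W" using x p K(2) sW by (auto intro: subspace_diff)
      then have "x - p \<in> W'"
        unfolding W'_def p_def using orth_proj_residual[OF h pos_on_any sK] by blast
      then obtain y where y: "\<forall>q\<in>{1..l}. y q \<in> H q" "x - p = (\<Sum>q = 1..l. y q)" using span by blast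
      have "x = (\<Sum>q = 1..l. y q) + p" using y(2) by (metis diff_add_cancel)
      also have "(\<Sum>q = 1..l. y q) = (\<Sum>q = 1..l. (y(Suc l := p)) q)" by (rule sum.cong) auto
      finally have "x = (\<Sum>q = 1..Suc l. (y(Suc l := p)) q)" by simp
      moreover have "(y(Suc l := p)) q \<in> G q" if "q \<in> {1..Suc l}" for q
        using split[OF that] y(1) p G1 G2 by auto
      ultimately show ?thesis by blast
    qed
    ultimately have "orthogonal_irreducible_sum (Suc l) G W"
      unfolding orthogonal_irreducible_sum_def by blast
    then show ?thesis by blast
  qed
qed

context
  fixes \<omega> :: "nat \<Rightarrow> real" and \<mu> :: real
  assumes \<omega>: "\<And>i. i \<in> {1..m} \<Longrightarrow> 0 < \<omega> i"
    and balanced: "\<And>v. (\<Sum>i = 1..m. complex_of_real (\<omega> i) *s orth_proj h (V i) v) = complex_of_real \<mu> *s v"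
begin

lemma balanced_trace:
  assumes B: "orthonormal_basis h K B"
  shows "(\<Sum>i = 1..m. \<omega> i * (\<Sum>b\<in>B. Re (h (orth_proj h (V i) b) b))) = \<mu> * real (dim K)"
proof -
  note Bp = orthonormal_basisD[OF h B]
  have "(\<Sum>i = 1..m. \<omega> i * (\<Sum>b\<in>B. Re (h (orth_proj h (V i) b) b)))
      = (\<Sum>b\<in>B. \<Sum>i = 1..m. \<omega> i * Re (h (orth_proj h (V i) b) b))"
    by (simp only: sum_distrib_left) (rule sum.swap)
  also have "\<dots> = (\<Sum>b\<in>B. Re (h (\<Sum>i = 1..m. complex_of_real (\<omega> i) *s orth_proj h (V i) b) b))"
    by (simp add: form_sum_left[OF h] form_scale_left[OF h])
  also have "\<dots> = (\<Sum>b\<in>B. \<mu>)"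
    unfolding balanced by (rule sum.cong[OF refl]) (simp add: form_scale_left[OF h] Bp(5))
  finally show ?thesis using orthonormal_basis_card[OF h B] by simp
qed

text \<open>
  The weighted sum of the traces on \<open>K\<close> is \<open>\<mu> dim K\<close>; as all weights are positive, equality of the sums
  forces equality for each \<open>i\<close>.
\<close>

lemma balanced_weighted_dim_le:
  assumes K: "subspace K"
  shows "(\<Sum>i = 1..m. \<omega> i * real (dim (V i \<inter> K))) \<le> \<mu> * real (dim K)"
    and "(\<Sum>i = 1..m. \<omega> i * real (dim (V i \<inter> K))) = \<mu> * real (dim K) \<longleftrightarrow> invariant_subspace K"
proof -
  obtain B where B: "orthonormal_basis h K B" using orthonormal_basis_exists[OF h pos_on_any K] .
  define t where "t i = (\<Sum>b\<in>B. Re (h (orth_proj h (V i) b) b))" for i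
  have t: "(\<Sum>i = 1..m. \<omega> i * t i) = \<mu> * real (dim K)"
    unfolding t_def by (rule balanced_trace[OF B])
  have le: "\<omega> i * real (dim (V i \<inter> K)) \<le> \<omega> i * t i" if "i \<in> {1..m}" for i
    using trace_compression_ge(1)[OF V[OF that] K B] \<omega>[OF that] unfolding t_def by simp
  have eq: "\<omega> i * real (dim (V i \<inter> K)) = \<omega> i * t i \<longleftrightarrow> orth_proj h (V i) ` K \<subseteq> K" if "i \<in> {1..m}" for i
    using trace_compression_ge(2)[OF V[OF that] K B] \<omega>[OF that] unfolding t_def by simp
  show "(\<Sum>i = 1..m. \<omega> i * real (dim (V i \<inter> K))) \<le> \<mu> * real (dim K)"
    unfolding t[symmetric] by (rule sum_mono[OF le])
  have "(\<Sum>i = 1..m. \<omega> i * real (dim (V i \<inter> K))) = (\<Sum>i = 1..m. \<omega> i * t i) \<longleftrightarrow>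
      (\<forall>i\<in>{1..m}. \<omega> i * real (dim (V i \<inter> K)) = \<omega> i * t i)"
    using sum_mono_inv[of "\<lambda>i. \<omega> i * real (dim (V i \<inter> K))" "{1..m}" "\<lambda>i. \<omega> i * t i"] le
    by (metis (no_types, lifting) finite_atLeastAtMost sum.cong)
  then show "(\<Sum>i = 1..m. \<omega> i * real (dim (V i \<inter> K))) = \<mu> * real (dim K) \<longleftrightarrow> invariant_subspace K"
    unfolding t[symmetric] invariant_subspace_def using eq K by blast
qed

text \<open>
  Equality at a smaller subspace would make that subspace invariant.
\<close>

lemma balanced_irreducible_stable:
  assumes H: "irreducible_subspace H"
  shows "normalized_weighted_dim m \<omega> H (induced V H) = \<mu>" and "stable m \<omega> H (induced V H)"
proof -
  have Hi: "invariant_subspace H" and H0: "H \<noteq> {0}" and sH: "subspace H"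
    using H by (auto simp: irreducible_subspace_def invariant_subspace_def)
  have dim_pos: "0 < real (dim K)" if "subspace K" "K \<noteq> {0}" for K
    using that subspace_0 dim_eq_0[of K] by fastforce
  show \<mu>: "normalized_weighted_dim m \<omega> H (induced V H) = \<mu>"
    unfolding normalized_weighted_dim_def induced_def
      balanced_weighted_dim_le(2)[OF sH, THEN iffD2, OF Hi]
    using dim_pos[OF sH H0] by (intro nonzero_mult_div_cancel_right) linarith
  show "stable m \<omega> H (induced V H)"
    unfolding stable_def \<mu>
  proof (intro allI impI, elim conjE)
    fix K assume K: "subspace K" "K \<noteq> {0}" "K \<subset> H"
    have "V i \<inter> H \<inter> K = V i \<inter> K" for i using K by blast
    then have e: "normalized_weighted_dim m \<omega> K (induced (induced V H) K)
        = (\<Sum>i = 1..m. \<omega> i * real (dim (V i \<inter> K))) / real (dim K)"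
      by (simp add: normalized_weighted_dim_def induced_def)
    have "\<not> invariant_subspace K" using H K unfolding irreducible_subspace_def by blast
    then have "(\<Sum>i = 1..m. \<omega> i * real (dim (V i \<inter> K))) < \<mu> * real (dim K)"
      using balanced_weighted_dim_le[OF K(1)] by linarith
    then show "normalized_weighted_dim m \<omega> K (induced (induced V H) K) < \<mu>"
      unfolding e using dim_pos[OF K(1,2)] by (simp add: divide_less_eq)
  qed
qed

text \<open>
  The projections preserve the irreducible summands, so applying \<open>\<pi> i\<close> to the components of a vector of
  \<open>V i\<close> shows that \<open>V i\<close> splits as well.
\<close>

lemma balanced_imp_polystable:
  assumes \<mu>: "\<mu> = normalized_weighted_dim m \<omega> UNIV V"
  shows "polystable m \<omega> UNIV V"
proof -
  have dim_pos: "0 < real (dim K)" if "subspace K" "K \<noteq> {0}" for K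
    using that subspace_0 dim_eq_0[of K] by fastforce
  have "semistable m \<omega> UNIV V"
    unfolding semistable_def \<mu>[symmetric]
  proof (intro allI impI, elim conjE)
    fix K assume K: "subspace K" "K \<noteq> {0}"
    then show "normalized_weighted_dim m \<omega> K (induced V K) \<le> \<mu>"
      using balanced_weighted_dim_le(1)[OF K(1)] dim_pos[OF K]
      by (simp add: normalized_weighted_dim_def induced_def divide_le_eq)
  qed
  moreover obtain l H where "orthogonal_irreducible_sum l H UNIV"
    using irreducible_decomposition[OF invariant_subspace_UNIV] by blast
  then have H: "\<forall>q\<in>{1..l}. irreducible_subspace (H q)"
    and orth: "\<forall>q\<in>{1..l}. \<forall>r\<in>{1..l}. q \<noteq> r \<longrightarrow> (\<forall>x\<in>H q. \<forall>y\<in>H r. h x y = 0)"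
    and span: "\<forall>x. \<exists>y. (\<forall>q\<in>{1..l}. y q \<in> H q) \<and> x = (\<Sum>q = 1..l. y q)"
    unfolding orthogonal_irreducible_sum_def by simp_all
  have Hsub: "subspace (H q)" if "q \<in> {1..l}" for q
    using H that by (simp add: irreducible_subspace_def invariant_subspace_def)
  have "direct_sum UNIV l H"
    by (rule orthogonal_direct_sum) (use Hsub orth span in auto)
  moreover have "direct_sum (V i) l (\<lambda>q. V i \<inter> H q)" if i: "i \<in> {1..m}" for i
  proof (rule orthogonal_direct_sum[OF V[OF i]])
    fix x assume x: "x \<in> V i"
    obtain y where y: "\<forall>q\<in>{1..l}. y q \<in> H q" "x = (\<Sum>q = 1..l. y q)" using span by blast
    define y' where "y' q = orth_proj h (V i) (y q)" for q
    have "orth_proj h (V i) (\<Sum>q\<in>A. y q) = (\<Sum>q\<in>A. y' q)" if "finite A" for A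
      using that
    proof (induction A rule: finite_induct)
      case empty
      then show ?case using orth_proj_id[OF h pos_on_any V[OF i]] subspace_0[OF V[OF i]] by simp
    next
      case (insert q A)
      then show ?case by (simp add: orth_proj_add[OF h pos_on_any V[OF i]] y'_def)
    qed
    then have "x = (\<Sum>q = 1..l. y' q)"
      using orth_proj_id[OF h pos_on_any V[OF i] x] y(2) by simp
    moreover have "y' q \<in> V i \<inter> H q" if q: "q \<in> {1..l}" for q
    proof -
      have "orth_proj h (V i) ` H q \<subseteq> H q"
        using H q i by (simp add: irreducible_subspace_def invariant_subspace_def)
      then show ?thesis using y(1) q orth_proj_mem[OF h pos_on_any V[OF i]] unfolding y'_def by blast
    qed
    ultimately show "\<exists>y. (\<forall>q\<in>{1..l}. y q \<in> V i \<inter> H q) \<and> x = (\<Sum>q = 1..l. y q)" by blast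
  next
    fix q assume "q \<in> {1..l}"
    then show "subspace (V i \<inter> H q) \<and> V i \<inter> H q \<subseteq> V i"
      using subspace_inter[OF V[OF i] Hsub] by blast
  next
    fix q r x y
    assume "q \<in> {1..l}" "r \<in> {1..l}" "q \<noteq> r" "x \<in> V i \<inter> H q" "y \<in> V i \<inter> H r"
    then show "h x y = 0" using orth by blast
  qed
  ultimately show ?thesis
    unfolding polystable_def config_direct_sum_def
    using H balanced_irreducible_stable unfolding irreducible_subspace_def
    by (intro conjI exI[of _ l] exI[of _ H]) (simp_all add: irreducible_subspace_def)
qed

end
end
end

section \<open>Gluing balance metrics along a polystable decomposition\<close>

text \<open>
  The balance equation with constant \<open>\<mu>\<close> is the fixed point equation for the residuals with weights
  \<open>\<omega> i / (\<Omega> - \<mu>)\<close>, since \<open>\<Sum>i. \<omega> i (1 - \<pi> i) = \<Omega> - \<Sum>i. \<omega> i \<pi> i\<close>.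
\<close>

lemma stable_imp_balanced_on:
  assumes W: "subspace W" and W0: "W \<noteq> {0}"
    and V: "\<And>i. i \<in> {1..m} \<Longrightarrow> subspace (V i) \<and> V i \<subseteq> W"
    and \<omega>: "\<And>i. i \<in> {1..m} \<Longrightarrow> 0 < \<omega> i"
    and stab: "stable m \<omega> W V"
  shows "\<exists>h. hermitian_form h \<and> pos_on W h \<and>
    (\<forall>x\<in>W. (\<Sum>i = 1..m. complex_of_real (\<omega> i) *s orth_proj h (V i) x)
      = complex_of_real (normalized_weighted_dim m \<omega> W V) *s x)"
proof -
  define \<mu> where "\<mu> = normalized_weighted_dim m \<omega> W V"
  define \<Omega> where "\<Omega> = (\<Sum>i = 1..m. \<omega> i)"
  have dim_pos: "0 < real (dim K)" if "subspace K" "K \<noteq> {0}" for K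
    using that subspace_0 dim_eq_0[of K] by fastforce
  note dW = dim_pos[OF W W0]
  have \<mu>: "(\<Sum>i = 1..m. \<omega> i * real (dim (V i))) = \<mu> * real (dim W)"
    unfolding \<mu>_def normalized_weighted_dim_def by (rule nonzero_divide_eq_eq[THEN iffD1, OF _ refl]) (use dW in linarith)
  have codim: "(\<Sum>i = 1..m. \<omega> i * (real (dim W) - real (dim (V i)))) = (\<Omega> - \<mu>) * real (dim W)"
    by (simp only: right_diff_distrib sum_subtractf \<mu>) (simp only: \<Omega>_def sum_distrib_right left_diff_distrib)
  have codim_nonneg: "0 \<le> \<omega> i * (real (dim W) - real (dim (V i)))" if "i \<in> {1..m}" for i
    using dim_subset[of "V i" W] V[OF that] \<omega>[OF that] by simp
  show ?thesis
  proof (cases "\<Omega> = \<mu>")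
    case True
    then have "(\<Sum>i = 1..m. \<omega> i * (real (dim W) - real (dim (V i)))) = 0" using codim by simp
    then have z: "\<omega> i * (real (dim W) - real (dim (V i))) = 0" if "i \<in> {1..m}" for i
      using sum_nonneg_eq_0_iff[of "{1..m}" "\<lambda>i. \<omega> i * (real (dim W) - real (dim (V i)))"]
        codim_nonneg that by blast
    have full: "V i = W" if "i \<in> {1..m}" for i
    proof (rule subspace_dim_equal)
      show "dim W \<le> dim (V i)" using z[OF that] \<omega>[OF that] by simp
    qed (use V[OF that] W in auto)
    obtain h where h: "hermitian_form h" "pos_on UNIV h" using hermitian_metric_exists by blast
    have hW: "pos_on W h" using pos_on_subset[OF h(2)] by blast
    have "(\<Sum>i = 1..m. complex_of_real (\<omega> i) *s orth_proj h (V i) x) = complex_of_real \<mu> *s x"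
      if x: "x \<in> W" for x
    proof -
      have "(\<Sum>i = 1..m. complex_of_real (\<omega> i) *s orth_proj h (V i) x)
          = (\<Sum>i = 1..m. complex_of_real (\<omega> i) *s x)"
        by (rule sum.cong[OF refl]) (simp only: full orth_proj_id[OF h(1) hW W x])
      also have "\<dots> = complex_of_real \<Omega> *s x"
        unfolding \<Omega>_def by (simp only: of_real_sum scale_sum_left)
      finally show ?thesis using True by simp
    qed
    then show ?thesis using h(1) hW unfolding \<mu>_def by blast
  next
    case False
    define D where "D = \<Omega> - \<mu>"
    have "0 \<le> D * real (dim W)" unfolding D_def codim[symmetric] by (rule sum_nonneg[OF codim_nonneg])
    then have "0 \<le> D" using dW by (simp only: zero_le_mult_iff) linarith
    then have D: "0 < D" using False unfolding D_def by linarith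
    define w where "w i = \<omega> i / D" for i
    have wsum: "(\<Sum>i = 1..m. w i * f i) = (\<Sum>i = 1..m. \<omega> i * f i) / D" for f :: "nat \<Rightarrow> real"
      by (simp add: w_def sum_divide_distrib)
    have norm: "(\<Sum>i = 1..m. w i * (real (dim W) - real (dim (V i)))) = real (dim W)"
      unfolding wsum codim D_def[symmetric] using D by simp
    have "\<exists>h. hermitian_form h \<and> pos_on W h \<and>
      (\<forall>x\<in>W. (\<Sum>i = 1..m. complex_of_real (w i) *s (x - orth_proj h (V i) x)) = x)"
    proof (rule stable_imp_residual_fixed_point[OF W V _ norm])
      show "0 \<le> w i" if "i \<in> {1..m}" for i using \<omega>[OF that] D by (simp add: w_def)
      fix N assume N: "subspace N" "N \<noteq> {0}" "N \<subset> W"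
      have "normalized_weighted_dim m \<omega> N (induced V N) < \<mu>"
        using stab N unfolding stable_def \<mu>_def by blast
      then have "(\<Sum>i = 1..m. \<omega> i * real (dim (V i \<inter> N))) < \<mu> * real (dim N)"
        using dim_pos[OF N(1,2)] unfolding normalized_weighted_dim_def induced_def
        by (simp only: pos_divide_less_eq)
      then have "D * real (dim N) < (\<Sum>i = 1..m. \<omega> i * (real (dim N) - real (dim (V i \<inter> N))))"
        by (simp only: right_diff_distrib sum_subtractf D_def left_diff_distrib \<Omega>_def sum_distrib_right)
      then show "real (dim N) < (\<Sum>i = 1..m. w i * (real (dim N) - real (dim (V i \<inter> N))))"
        unfolding wsum using D by (simp only: pos_less_divide_eq mult.commute)
    qed
    then obtain h where h: "hermitian_form h" "pos_on W h"
      and fix_eq: "\<forall>x\<in>W. (\<Sum>i = 1..m. complex_of_real (w i) *s (x - orth_proj h (V i) x)) = x" by blast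
    have "(\<Sum>i = 1..m. complex_of_real (\<omega> i) *s orth_proj h (V i) x) = complex_of_real \<mu> *s x"
      if x: "x \<in> W" for x
    proof -
      have "complex_of_real D *s x
          = complex_of_real D *s (\<Sum>i = 1..m. complex_of_real (w i) *s (x - orth_proj h (V i) x))"
        using fix_eq x by simp
      also have "\<dots> = (\<Sum>i = 1..m. complex_of_real (\<omega> i) *s (x - orth_proj h (V i) x))"
        unfolding scale_sum_right
      proof (rule sum.cong[OF refl])
        fix i
        have "complex_of_real D * complex_of_real (w i) = complex_of_real (\<omega> i)"
          using D by (simp add: w_def)
        then show "complex_of_real D *s complex_of_real (w i) *s (x - orth_proj h (V i) x)
            = complex_of_real (\<omega> i) *s (x - orth_proj h (V i) x)" by (simp only: scale_scale)
      qed
      also have "\<dots> = complex_of_real \<Omega> *s x - (\<Sum>i = 1..m. complex_of_real (\<omega> i) *s orth_proj h (V i) x)"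
        unfolding \<Omega>_def by (simp only: of_real_sum scale_sum_left scale_right_diff_distrib sum_subtractf)
      finally have "(\<Sum>i = 1..m. complex_of_real (\<omega> i) *s orth_proj h (V i) x)
          = complex_of_real \<Omega> *s x - complex_of_real D *s x" by (simp add: algebra_simps)
      also have "\<dots> = complex_of_real \<mu> *s x"
        by (simp add: D_def scale_left_diff_distrib)
      finally show ?thesis .
    qed
    then show ?thesis using h unfolding \<mu>_def by blast
  qed
qed

lemma direct_sum_components:
  assumes "direct_sum W l H"
  obtains c where "\<And>x q. x \<in> W \<Longrightarrow> q \<in> {1..l} \<Longrightarrow> c x q \<in> H q"
    "\<And>x. x \<in> W \<Longrightarrow> (\<Sum>q = 1..l. c x q) = x"
    "\<And>x y q. (\<And>q. q \<in> {1..l} \<Longrightarrow> y q \<in> H q) \<Longrightarrow> x = (\<Sum>q = 1..l. y q) \<Longrightarrow> q \<in> {1..l} \<Longrightarrow> c x q = y q"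
proof -
  define f where "f x = (\<Sum>q = 1..l. x q)" for x :: "nat \<Rightarrow> 'v"
  have bij: "bij_betw f (\<Pi>\<^sub>E q\<in>{1..l}. H q) W"
    using assms unfolding direct_sum_def f_def by blast
  define c where "c = inv_into (\<Pi>\<^sub>E q\<in>{1..l}. H q) f"
  have c: "c x \<in> (\<Pi>\<^sub>E q\<in>{1..l}. H q)" "f (c x) = x" if "x \<in> W" for x
    using that unfolding c_def bij_betw_imp_surj_on[OF bij, symmetric]
    by (rule inv_into_into, rule f_inv_into_f)
  show thesis
  proof (rule that[of c])
    show "c x q \<in> H q" if "x \<in> W" "q \<in> {1..l}" for x q using c(1)[OF that(1)] that(2) by (rule PiE_mem)
    show "(\<Sum>q = 1..l. c x q) = x" if "x \<in> W" for x using c(2)[OF that] unfolding f_def .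
    fix x y q
    assume y: "\<And>q. q \<in> {1..l} \<Longrightarrow> y q \<in> H q" and x: "x = (\<Sum>q = 1..l. y q)" and q: "q \<in> {1..l}"
    have r: "restrict y {1..l} \<in> (\<Pi>\<^sub>E q\<in>{1..l}. H q)" using y by auto
    have "f (restrict y {1..l}) = x" unfolding f_def x by (rule sum.cong) auto
    then have "c x = restrict y {1..l}"
      using inv_into_f_f[OF bij_betw_imp_inj_on[OF bij] r] unfolding c_def by simp
    then show "c x q = y q" using q by simp
  qed
qed

lemma hermitian_form_sum:
  assumes "\<And>q. q \<in> A \<Longrightarrow> hermitian_form (f q)"
  shows "hermitian_form (\<lambda>x y. \<Sum>q\<in>A. f q x y)"
proof (rule hermitian_formI)
  fix x y z c
  show "(\<Sum>q\<in>A. f q (x + y) z) = (\<Sum>q\<in>A. f q x z) + (\<Sum>q\<in>A. f q y z)"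
    unfolding sum.distrib[symmetric] by (rule sum.cong[OF refl]) (rule form_add_left[OF assms])
  show "(\<Sum>q\<in>A. f q (c *s x) y) = c * (\<Sum>q\<in>A. f q x y)"
    unfolding sum_distrib_left by (rule sum.cong[OF refl]) (rule form_scale_left[OF assms])
  show "(\<Sum>q\<in>A. f q y x) = cnj (\<Sum>q\<in>A. f q x y)"
    unfolding cnj_sum by (rule sum.cong[OF refl]) (rule form_cnj[OF assms])
qed

text \<open>
  Make the summands orthogonal to each other. Since \<open>V i\<close> is compatible with the decomposition, its
  projection is the sum of the projections in the summands. The common constant must be the normalized
  dimension of the whole configuration, as a trace over the whole space shows.
\<close>

lemma polystable_imp_balance_metric:
  assumes V: "\<And>i. i \<in> {1..m} \<Longrightarrow> subspace (V i)"
    and \<omega>: "\<And>i. i \<in> {1..m} \<Longrightarrow> 0 < \<omega> i"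
    and poly: "polystable m \<omega> UNIV V"
  shows "\<exists>h. balance_metric m \<omega> V h"
proof -
  obtain l H where H0: "\<forall>q\<in>{1..l}. H q \<noteq> {0}"
    and ds: "config_direct_sum m UNIV V l H"
    and st: "\<forall>q\<in>{1..l}. stable m \<omega> (H q) (induced V (H q))"
    and same: "\<forall>q\<in>{1..l}. \<forall>r\<in>{1..l}. normalized_weighted_dim m \<omega> (H q) (induced V (H q)) =
        normalized_weighted_dim m \<omega> (H r) (induced V (H r))"
    using poly unfolding polystable_def by blast
  define \<mu> where "\<mu> = normalized_weighted_dim m \<omega> (H 1) (induced V (H 1))"
  have dsU: "direct_sum UNIV l H" and dsV: "\<And>i. i \<in> {1..m} \<Longrightarrow> direct_sum (V i) l (\<lambda>q. V i \<inter> H q)"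
    using ds by (auto simp: config_direct_sum_def)
  have sH: "subspace (H q)" if "q \<in> {1..l}" for q using dsU that by (simp add: direct_sum_def)
  have sVH: "subspace (V i \<inter> H q)" if "i \<in> {1..m}" "q \<in> {1..l}" for i q
    using subspace_inter[OF V[OF that(1)] sH[OF that(2)]] .
  have \<mu>: "normalized_weighted_dim m \<omega> (H q) (induced V (H q)) = \<mu>" if "q \<in> {1..l}" for q
  proof -
    have "1 \<in> {1..l}" using that by auto
    then show ?thesis using same that unfolding \<mu>_def by blast
  qed
  have "\<forall>q\<in>{1..l}. \<exists>g. hermitian_form g \<and> pos_on (H q) g \<and>
    (\<forall>x\<in>H q. (\<Sum>i = 1..m. complex_of_real (\<omega> i) *s orth_proj g (V i \<inter> H q) x)
      = complex_of_real \<mu> *s x)"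
  proof
    fix q assume q: "q \<in> {1..l}"
    have VH: "subspace (induced V (H q) i) \<and> induced V (H q) i \<subseteq> H q" if "i \<in> {1..m}" for i
      using sVH[OF that q] by (simp add: induced_def)
    from stable_imp_balanced_on[OF sH[OF q] H0[rule_format, OF q] VH \<omega> st[rule_format, OF q]]
    show "\<exists>g. hermitian_form g \<and> pos_on (H q) g \<and>
      (\<forall>x\<in>H q. (\<Sum>i = 1..m. complex_of_real (\<omega> i) *s orth_proj g (V i \<inter> H q) x)
        = complex_of_real \<mu> *s x)"
      unfolding \<mu>[OF q] unfolding induced_def .
  qed
  from bchoice[OF this] obtain g where g: "\<And>q. q \<in> {1..l} \<Longrightarrow> hermitian_form (g q)"
    and gpos: "\<And>q. q \<in> {1..l} \<Longrightarrow> pos_on (H q) (g q)"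
    and gbal: "\<And>q x. q \<in> {1..l} \<Longrightarrow> x \<in> H q \<Longrightarrow>
      (\<Sum>i = 1..m. complex_of_real (\<omega> i) *s orth_proj (g q) (V i \<inter> H q) x) = complex_of_real \<mu> *s x"
    by blast
  obtain c where c: "\<And>x q. q \<in> {1..l} \<Longrightarrow> c x q \<in> H q" "\<And>x. (\<Sum>q = 1..l. c x q) = x"
    and c_unique: "\<And>x y q. (\<And>q. q \<in> {1..l} \<Longrightarrow> y q \<in> H q) \<Longrightarrow> x = (\<Sum>q = 1..l. y q) \<Longrightarrow> q \<in> {1..l} \<Longrightarrow> c x q = y q"
    by (rule direct_sum_components[OF dsU]) (simp only: UNIV_I, blast)
  have c_add: "c (x + y) q = c x q + c y q" if "q \<in> {1..l}" for x y q
    by (rule c_unique[OF _ _ that, of "\<lambda>q. c x q + c y q"])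
      (simp_all only: subspace_add[OF sH] c sum.distrib)
  have c_diff: "c (x - y) q = c x q - c y q" if "q \<in> {1..l}" for x y q
    by (rule c_unique[OF _ _ that, of "\<lambda>q. c x q - c y q"])
      (simp_all only: subspace_diff[OF sH] c sum_subtractf)
  have c_scale: "c (a *s x) q = a *s c x q" if "q \<in> {1..l}" for a x q
    by (rule c_unique[OF _ _ that, of "\<lambda>q. a *s c x q"])
      (simp_all only: subspace_scale[OF sH] c scale_sum_right[symmetric])
  have c_V: "c x q \<in> V i" if i: "i \<in> {1..m}" and q: "q \<in> {1..l}" and x: "x \<in> V i" for i q x
  proof -
    obtain d where d: "\<And>x q. x \<in> V i \<Longrightarrow> q \<in> {1..l} \<Longrightarrow> d x q \<in> V i \<inter> H q"
      "\<And>x. x \<in> V i \<Longrightarrow> (\<Sum>q = 1..l. d x q) = x"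
      using direct_sum_components[OF dsV[OF i]] by metis
    have "c x q = d x q"
      by (rule c_unique[OF _ _ q]) (use d x in auto)
    then show ?thesis using d(1)[OF x q] by simp
  qed
  define h where "h x y = (\<Sum>q = 1..l. g q (c x q) (c y q))" for x y
  have h: "hermitian_form h" unfolding h_def
    by (rule hermitian_form_sum) (rule hermitian_form_pullback[OF g c_add c_scale])
  have gnonneg: "0 \<le> Re (g q (c x q) (c x q))" if "q \<in> {1..l}" for q x
    using pos_on_imp_psd_on[OF g[OF that] gpos[OF that]] c(1)[OF that] unfolding psd_on_def by blast
  have hpos: "pos_on UNIV h" unfolding pos_on_def
  proof (intro ballI impI)
    fix x :: 'v assume "x \<noteq> 0"
    have "\<exists>q\<in>{1..l}. c x q \<noteq> 0"
    proof (rule ccontr)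
      assume "\<not> ?thesis"
      then have "(\<Sum>q = 1..l. c x q) = 0" by (intro sum.neutral) blast
      with c(2)[of x] \<open>x \<noteq> 0\<close> show False by simp
    qed
    then obtain q where q: "q \<in> {1..l}" "c x q \<noteq> 0" by blast
    have "0 < Re (g q (c x q) (c x q))"
      using gpos[OF q(1)] c(1)[OF q(1)] q(2) unfolding pos_on_def by blast
    then have "0 < (\<Sum>q = 1..l. Re (g q (c x q) (c x q)))"
      using q(1) gnonneg by (intro sum_pos2[of _ q]) auto
    then show "0 < Re (h x x)" by (simp add: h_def)
  qed
  have hproj: "orth_proj h (V i) x = (\<Sum>q = 1..l. orth_proj (g q) (V i \<inter> H q) (c x q))"
    if i: "i \<in> {1..m}" for i x
  proof (rule orth_projI[OF h pos_on_subset[OF hpos subset_UNIV] V[OF i]])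
    define p where "p q = orth_proj (g q) (V i \<inter> H q) (c x q)" for q
    have gp: "pos_on (V i \<inter> H q) (g q)" if "q \<in> {1..l}" for q
      using pos_on_subset[OF gpos[OF that]] by blast
    have p: "p q \<in> V i \<inter> H q" if "q \<in> {1..l}" for q
      unfolding p_def by (rule orth_proj_mem[OF g[OF that] gp[OF that] sVH[OF i that]])
    show "(\<Sum>q = 1..l. orth_proj (g q) (V i \<inter> H q) (c x q)) \<in> V i"
      unfolding p_def[symmetric] using p by (intro subspace_sum[OF V[OF i]]) blast
    fix s assume s: "s \<in> V i"
    have cp: "c (\<Sum>q = 1..l. p q) q = p q" if "q \<in> {1..l}" for q
      by (rule c_unique[OF _ refl that]) (use p in blast)
    have "g q (c x q - p q) (c s q) = 0" if q: "q \<in> {1..l}" for q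
    proof -
      have "c s q \<in> V i \<inter> H q" using c_V[OF i q s] c(1)[OF q] by blast
      then show ?thesis
        unfolding p_def by (rule orth_proj_residual[OF g[OF q] gp[OF q] sVH[OF i q]])
    qed
    then show "h (x - (\<Sum>q = 1..l. orth_proj (g q) (V i \<inter> H q) (c x q))) s = 0"
      unfolding p_def[symmetric] h_def
      by (intro sum.neutral ballI) (simp only: c_diff cp)
  qed
  have bal: "(\<Sum>i = 1..m. complex_of_real (\<omega> i) *s orth_proj h (V i) x) = complex_of_real \<mu> *s x" for x
  proof -
    have "(\<Sum>i = 1..m. complex_of_real (\<omega> i) *s orth_proj h (V i) x)
        = (\<Sum>i = 1..m. \<Sum>q = 1..l. complex_of_real (\<omega> i) *s orth_proj (g q) (V i \<inter> H q) (c x q))"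
      by (rule sum.cong[OF refl]) (simp only: hproj scale_sum_right)
    also have "\<dots> = (\<Sum>q = 1..l. \<Sum>i = 1..m. complex_of_real (\<omega> i) *s orth_proj (g q) (V i \<inter> H q) (c x q))"
      by (rule sum.swap)
    also have "\<dots> = (\<Sum>q = 1..l. complex_of_real \<mu> *s c x q)"
      by (rule sum.cong[OF refl]) (simp only: gbal c)
    also have "\<dots> = complex_of_real \<mu> *s x" by (simp only: scale_sum_right[symmetric] c)
    finally show ?thesis .
  qed
  have "complex_of_real \<mu> *s x = complex_of_real (normalized_weighted_dim m \<omega> UNIV V) *s x" for x
  proof (cases "x = 0")
    case False
    then have "dim (UNIV :: 'v set) \<noteq> 0" using dim_eq_0[of UNIV] by blast
    then have ne: "real (dim (UNIV :: 'v set)) \<noteq> 0" by simp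
    have "invariant_subspace h m V UNIV" by (rule invariant_subspace_UNIV[OF h hpos V])
    then have "(\<Sum>i = 1..m. \<omega> i * real (dim (V i \<inter> UNIV))) = \<mu> * real (dim (UNIV :: 'v set))"
      using balanced_weighted_dim_le(2)[OF h hpos V \<omega> bal subspace_UNIV] by blast
    then show ?thesis
      unfolding normalized_weighted_dim_def Int_UNIV_right
      by (simp only: nonzero_mult_div_cancel_right[OF ne])
  qed simp
  then have "balance_metric m \<omega> V h"
    unfolding balance_metric_def hermitian_metric_iff using h hpos bal by metis
  then show ?thesis by blast
qed

theorem polystable_iff_balance_metric:
  assumes V: "\<And>i. i \<in> {1..m} \<Longrightarrow> subspace (V i)"
    and \<omega>: "\<And>i. i \<in> {1..m} \<Longrightarrow> 0 < \<omega> i"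
  shows "polystable m \<omega> UNIV V \<longleftrightarrow> (\<exists>h. balance_metric m \<omega> V h)"
proof
  assume "\<exists>h. balance_metric m \<omega> V h"
  then obtain h where h: "hermitian_form h" "pos_on UNIV h"
    and bal: "\<And>v. (\<Sum>i = 1..m. complex_of_real (\<omega> i) *s orth_proj h (V i) v) =
         complex_of_real (normalized_weighted_dim m \<omega> UNIV V) *s v"
    unfolding balance_metric_def hermitian_metric_iff by blast
  show "polystable m \<omega> UNIV V" by (rule balanced_imp_polystable[OF h V \<omega> bal refl])
qed (rule polystable_imp_balance_metric[OF V \<omega>])

end

theorem theorem3p5:
  fixes scale :: "complex \<Rightarrow> 'v::ab_group_add \<Rightarrow> 'v"
    and Basis :: "'v set"
    and m :: nat
    and k :: "nat \<Rightarrow> nat"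
    and V :: "nat \<Rightarrow> 'v set"
    and \<omega> :: "nat \<Rightarrow> real"
  assumes "fd_complex_vector_space scale Basis"
    and "\<And>i. i \<in> {1..m} \<Longrightarrow> V i \<in> fd_complex_vector_space.Gr scale (k i) UNIV"
    and "\<And>i. i \<in> {1..m} \<Longrightarrow> \<omega> i > 0"
  shows "fd_complex_vector_space.polystable scale m \<omega> UNIV V \<longleftrightarrow>
    (\<exists>h. fd_complex_vector_space.balance_metric scale m \<omega> V h)"
proof -
  interpret fd_complex_vector_space scale Basis by (rule assms(1))
  have "subspace (V i)" if "i \<in> {1..m}" for i using assms(2)[OF that] by (simp add: Gr_def)
  then show ?thesis using assms(3) by (rule polystable_iff_balance_metric)
qed

end
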